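(* Let $\mathcal{T}$ be a triangulation of $\Omega\subset\mathbb{R}^2$ in which a complete neighborhood of two adjacent vertices consists only of equilateral triangles; that is, there are two vertices $z_1,z_2\in\Omega$ of $\mathcal{T}$ joined by an edge such that all triangles of $\mathcal{T}$ having $z_1$ or $z_2$ as a vertex are equilateral (their closures forming a neighborhood of $z_1$ and of $z_2$). Then the ball $$B_{\mathring{P}_1}=\{u\in\mathring{P}_1(\mathcal{T}) : \mathrm{TV}(u,\Omega)\le 1\}$$ has infinitely many extremal points.
   Context: $\Omega\subset\mathbb{R}^2$ is an open, bounded, connected polygon with strongly Lipschitz boundary; $\mathcal{T}$ is a (conforming) triangulation of $\Omega$, i.e. a finite collection of pairwise disjoint open triangles whose closures cover $\overline{\Omega}$, the closures of two distinct triangles meeting, if at all, in a common vertex or a common edge. $P_1(\mathcal{T})$ is the space of continuous functions on $\Omega$ that are affine on each triangle of $\mathcal{T}$, and $\mathring{P}_1(\mathcal{T})=\{u\in P_1(\mathcal{T}):\int_\Omega u\,dx=0\}$. The total variation is $\mathrm{TV}(u,\Omega)=\sup\{\int_\Omega u\,\mathrm{div}\,\psi\,dx:\psi\in C^1_c(\Omega;\mathbb{R}^2),\ \sup_x|\psi(x)|\le1\}$ with $|\cdot|$ the Euclidean norm. An element $u$ of a convex set $B$ is extremal if there are no $s\in(0,1)$ and $u_1\neq u_2$ in $B$ with $u=(1-s)u_1+su_2$. *)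

theory Defs
  imports "HOL-Analysis.Analysis"
begin

section \<open>Polygons with strongly Lipschitz boundary\<close>

definition polygonal_boundary :: "(real^2) set \<Rightarrow> bool" where
  "polygonal_boundary \<Omega> \<longleftrightarrow>
     (\<exists>S. finite S \<and> frontier \<Omega> = (\<Union>(a, b)\<in>S. closed_segment a b))"

text \<open>
  Near every boundary point \<open>p\<close>, in suitable Cartesian coordinates \<open>(s, t)\<close> centred at \<open>p\<close> with axes
  \<open>e\<close>, \<open>f\<close>, the set is the part of a rectangle lying strictly above the graph of a Lipschitz
  function. That the boundary coincides with the graph inside the rectangle is a consequence.
\<close>

definition strongly_Lipschitz_boundary :: "(real^2) set \<Rightarrow> bool" where
  "strongly_Lipschitz_boundary \<Omega> \<longleftrightarrow>
     (\<forall>p\<in>frontier \<Omega>. \<exists>e f r h L \<gamma>.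
        norm e = 1 \<and> norm f = 1 \<and> e \<bullet> f = 0 \<and> 0 < r \<and> 0 < h \<and>
        L-lipschitz_on {-r<..<r} (\<gamma> :: real \<Rightarrow> real) \<and>
        (\<forall>x. \<bar>(x - p) \<bullet> e\<bar> < r \<and> \<bar>(x - p) \<bullet> f\<bar> < h \<longrightarrow>
             (x \<in> \<Omega> \<longleftrightarrow> \<gamma> ((x - p) \<bullet> e) < (x - p) \<bullet> f)))"

text \<open>Holes are allowed; a polygon is not required to be simply connected.\<close>

definition polygonal_domain :: "(real^2) set \<Rightarrow> bool" where
  "polygonal_domain \<Omega> \<longleftrightarrow>
     open \<Omega> \<and> bounded \<Omega> \<and> connected \<Omega> \<and> polygonal_boundary \<Omega> \<and> strongly_Lipschitz_boundary \<Omega>"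


section \<open>Triangulations\<close>

definition open_triangle :: "(real^2) set \<Rightarrow> bool" where
  "open_triangle T \<longleftrightarrow>
     (\<exists>a b c. \<not> collinear {a, b, c} \<and> T = interior (convex hull {a, b, c}))"

definition vertices :: "(real^2) set \<Rightarrow> (real^2) set" where
  "vertices T = {v. v extreme_point_of closure T}"

lemma vertices_open_triangle:
  assumes "\<not> collinear {a,b,c::real^2}"
  shows "vertices (interior (convex hull {a,b,c})) = {a,b,c}"
proof -
  have d: "a\<noteq>b" "b\<noteq>c" "a\<noteq>c" using assms by (auto simp: insert_commute)
  have ai: "\<not> affine_dependent {a,b,c}" using assms affine_dependent_imp_collinear_3 by blast
  have "interior (convex hull {a,b,c}) \<noteq> {}"
    using interior_convex_hull_eq_empty[of "{a,b,c}"] d ai by simp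
  then have "closure (interior (convex hull {a,b,c})) = convex hull {a,b,c}"
    by (simp add: convex_closure_interior compact_imp_closed finite_imp_compact_convex_hull)
  then show ?thesis unfolding vertices_def
    using extreme_point_of_convex_hull_affine_independent[OF ai] by auto
qed

definition equilateral :: "(real^2) set \<Rightarrow> bool" where
  "equilateral T \<longleftrightarrow> (\<exists>l. \<forall>v\<in>vertices T. \<forall>w\<in>vertices T. v \<noteq> w \<longrightarrow> dist v w = l)"

text \<open>
  Unlike the library's \<open>triangulation\<close>, which is a family of closed simplices of arbitrary dimension,
  the members here are open triangles, and the domain they cover is part of the notion.
\<close>

definition triangulation_of :: "(real^2) set \<Rightarrow> (real^2) set set \<Rightarrow> bool" where
  "triangulation_of \<Omega> \<T> \<longleftrightarrow>
     finite \<T> \<and> (\<forall>T\<in>\<T>. open_triangle T \<and> T \<subseteq> \<Omega>) \<and> pairwise disjnt \<T> \<and>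
     closure \<Omega> \<subseteq> (\<Union>T\<in>\<T>. closure T) \<and>
     (\<forall>T\<in>\<T>. \<forall>T'\<in>\<T>. T \<noteq> T' \<longrightarrow>
        closure T \<inter> closure T' = {} \<or>
        (\<exists>v \<in> vertices T \<inter> vertices T'. closure T \<inter> closure T' = {v}) \<or>
        (\<exists>v \<in> vertices T \<inter> vertices T'. \<exists>w \<in> vertices T \<inter> vertices T'.
            v \<noteq> w \<and> closure T \<inter> closure T' = closed_segment v w))"


section \<open>Piecewise affine functions\<close>

text \<open>
  A function on \<open>\<Omega>\<close> is represented by its extension by zero to the plane, so that two such functions
  are equal iff they agree on \<open>\<Omega>\<close>.
\<close>

definition P1 :: "(real^2) set \<Rightarrow> (real^2) set set \<Rightarrow> (real^2 \<Rightarrow> real) set" where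
  "P1 \<Omega> \<T> = {u. continuous_on \<Omega> u \<and> (\<forall>T\<in>\<T>. \<exists>a c. \<forall>x\<in>T. u x = a \<bullet> x + c) \<and>
                 (\<forall>x. x \<notin> \<Omega> \<longrightarrow> u x = 0)}"

definition P1_mean_zero :: "(real^2) set \<Rightarrow> (real^2) set set \<Rightarrow> (real^2 \<Rightarrow> real) set" where
  "P1_mean_zero \<Omega> \<T> = {u \<in> P1 \<Omega> \<T>. (LINT x:\<Omega>|lborel. u x) = 0}"


section \<open>Total variation\<close>

definition divergence :: "(real^2 \<Rightarrow> real^2) \<Rightarrow> real^2 \<Rightarrow> real" where
  "divergence \<psi> x = (\<Sum>i\<in>UNIV. frechet_derivative \<psi> (at x) (axis i 1) $ i)"

text \<open>
  \<open>C\<^sup>1\<close> vector fields with compact support in \<open>\<Omega>\<close>, extended by zero to the plane. Continuity of the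
  derivative is expressed through the directional derivatives, which suffices in finite dimension.
\<close>

definition C1c :: "(real^2) set \<Rightarrow> (real^2 \<Rightarrow> real^2) set" where
  "C1c \<Omega> = {\<psi>. (\<forall>x. \<psi> differentiable (at x)) \<and>
                (\<forall>v. continuous_on UNIV (\<lambda>x. frechet_derivative \<psi> (at x) v)) \<and>
                (\<exists>K. compact K \<and> K \<subseteq> \<Omega> \<and> (\<forall>x. x \<notin> K \<longrightarrow> \<psi> x = 0))}"

definition TV :: "(real^2 \<Rightarrow> real) \<Rightarrow> (real^2) set \<Rightarrow> ereal" where
  "TV u \<Omega> = (SUP \<psi> \<in> {\<psi> \<in> C1c \<Omega>. \<forall>x. norm (\<psi> x) \<le> 1}.
                ereal (LINT x:\<Omega>|lborel. u x * divergence \<psi> x))"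

definition TV_ball :: "(real^2) set \<Rightarrow> (real^2) set set \<Rightarrow> (real^2 \<Rightarrow> real) set" where
  "TV_ball \<Omega> \<T> = {u \<in> P1_mean_zero \<Omega> \<T>. TV u \<Omega> \<le> 1}"


section \<open>Extremal points\<close>

text \<open>
  The same notion as \<open>extreme_point_of\<close>, which is not available here because the function type
  is not an instance of \<open>real_vector\<close>.
\<close>

definition extremal_in :: "('a \<Rightarrow> real) \<Rightarrow> ('a \<Rightarrow> real) set \<Rightarrow> bool" where
  "extremal_in u B \<longleftrightarrow> u \<in> B \<and>
     \<not> (\<exists>s u1 u2. 0 < s \<and> s < 1 \<and> u1 \<in> B \<and> u2 \<in> B \<and> u1 \<noteq> u2 \<and>
           u = (\<lambda>x. (1 - s) * u1 x + s * u2 x))"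

end

theory Submission
  imports Defs
begin

text \<open>
  A function of \<open>P1 \<Omega> \<T>\<close> has a constant gradient on each triangle, and its total variation is
  the sum over the triangles of area times length of the gradient (\<open>TV_eq_energy\<close>). If a function
  \<open>u\<close> of energy one is a proper convex combination of \<open>u1\<close> and \<open>u2\<close> in the unit ball, the triangle
  inequality for gradients must be an equality on every triangle, so the gradients of \<open>u1\<close> and
  \<open>u2\<close> are, triangle by triangle, multiples of the gradient of \<open>u\<close>. Hence \<open>u\<close> is extremal as soon
  as it is \<open>rigid\<close>: every \<open>v\<close> whose gradients are triangle-wise multiples of those of \<open>u\<close> has one
  and the same factor on all triangles (\<open>rigid_imp_extremal\<close>).

  Rigidity comes from strict extrema at vertices. Suppose that \<open>u\<close> differs from \<open>u z\<close> everywhere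
  near \<open>z\<close> except at \<open>z\<close>. The quotient \<open>(v x - v z) / (u x - u z)\<close> is then continuous on a punctured
  disc around \<open>z\<close>, where it takes only the finitely many triangle-wise factors as values. A punctured
  disc of the plane is connected, so all triangles at \<open>z\<close> have the same factor
  (\<open>proportional_around_point\<close>).

  For \<open>t > 0\<close> take the interpolant with value \<open>1\<close> at \<open>z1\<close>, value \<open>- t\<close> at \<open>z2\<close> and value \<open>0\<close> at all
  other vertices. It has a strict maximum at \<open>z1\<close> and a strict minimum at \<open>z2\<close>, a triangle at the
  edge \<open>z1 z2\<close> makes the two factors equal, and on a triangle with neither \<open>z1\<close> nor \<open>z2\<close> as a vertex the
  function is zero. So it is rigid. Subtracting the mean and dividing by the energy gives an extremal point; it remembers
  \<open>t\<close> as a ratio of directional derivatives, so different \<open>t\<close> give different extremal points.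

  The formula for the total variation rests on integration by parts for \<open>u * \<psi>\<close>, where \<open>u\<close> is
  piecewise affine and \<open>\<psi>\<close> is a test field. This product is Lipschitz with compact support, so its
  difference quotients have integral zero by translation invariance and converge boundedly to its
  partial derivatives (\<open>integral_directional_derivative_eq_0\<close>).
\<close>


section \<open>Affine functions and triangles\<close>

lemma affine_function_eq_on_open:
  fixes a a' :: "'a::real_inner"
  assumes "open U" "U \<noteq> {}" and eq: "\<And>x. x \<in> U \<Longrightarrow> a \<bullet> x + c = a' \<bullet> x + c'"
  shows "a = a'" "c = c'"
proof -
  obtain x where x: "x \<in> U" using assms by blast
  obtain e where e: "e > 0" "ball x e \<subseteq> U" using assms(1) x openE by blast
  define s where "s = e / (2 * (norm (a - a') + 1))"
  have np: "norm (a - a') + 1 > 0" by (simp add: add_nonneg_pos)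
  have s: "s > 0" using e np by (simp add: s_def)
  have "s * norm (a - a') \<le> s * (norm (a - a') + 1)" using s by simp
  also have "\<dots> = e / 2" using np by (simp add: s_def field_simps)
  also have "\<dots> < e" using e by simp
  finally have "x + s *\<^sub>R (a - a') \<in> U" using e s by (auto simp: dist_norm intro!: subsetD[OF e(2)])
  from eq[OF this] eq[OF x] have "s * ((a - a') \<bullet> (a - a')) = 0"
    by (simp add: algebra_simps)
  with s show "a = a'" by simp
  with eq[OF x] show "c = c'" by simp
qed

lemma affine_interpolation:
  fixes a b c :: "real^2"
  assumes "\<not> collinear {a,b,c}"
  shows "\<exists>g k. g \<bullet> a + k = p \<and> g \<bullet> b + k = q \<and> g \<bullet> c + k = r"
proof -
  have d: "a\<noteq>b" "b\<noteq>c" "a\<noteq>c" using assms by (auto simp: insert_commute)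
  have ai: "\<not> affine_dependent {a,b,c}" using assms affine_dependent_imp_collinear_3 by blast
  then have ind: "independent {b - a, c - a}"
    using affine_dependent_iff_dependent2[of a "{a,b,c}"] d by (auto simp: insert_Diff_if)
  obtain f where f: "linear f" "\<forall>x\<in>{b - a, c - a}. f x = (if x = b - a then q - p else r - p)"
    using linear_independent_extend[OF ind, of "\<lambda>x. if x = b - a then q - p else r - p"] by blast
  define g where "g = adjoint f 1"
  have g: "g \<bullet> x = f x" for x
    using adjoint_works[OF f(1), of x 1] by (simp add: g_def inner_commute)
  have "g \<bullet> (b - a) = q - p" "g \<bullet> (c - a) = r - p" using f(2) d by (auto simp: g)
  then show ?thesis
    by (intro exI[of _ g] exI[of _ "p - g \<bullet> a"]) (simp add: inner_diff_right)
qed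

lemma open_triangleE:
  assumes "open_triangle T"
  obtains a b c where "\<not> collinear {a,b,c}" "T = interior (convex hull {a,b,c})"
    "vertices T = {a,b,c}" "closure T = convex hull {a,b,c}" "T \<noteq> {}" "a \<noteq> b" "b \<noteq> c" "a \<noteq> c"
proof -
  obtain a b c where abc: "\<not> collinear {a,b,c}" "T = interior (convex hull {a,b,c})"
    using assms unfolding open_triangle_def by blast
  have d: "a\<noteq>b" "b\<noteq>c" "a\<noteq>c" using abc by (auto simp: insert_commute)
  have ai: "\<not> affine_dependent {a,b,c}" using abc affine_dependent_imp_collinear_3 by blast
  have ne: "interior (convex hull {a,b,c}) \<noteq> {}"
    using interior_convex_hull_eq_empty[of "{a,b,c}"] d ai by simp
  then have "closure T = convex hull {a,b,c}"
    by (simp add: abc convex_closure_interior compact_imp_closed finite_imp_compact_convex_hull)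
  with that abc ne vertices_open_triangle[OF abc(1)] d show ?thesis by metis
qed

lemma open_triangle_basic:
  assumes "open_triangle T"
  shows "open T" "convex T" "bounded T" "T \<noteq> {}" "compact (closure T)"
proof -
  obtain a b c where T: "T = interior (convex hull {a,b,c})" "closure T = convex hull {a,b,c}" "T \<noteq> {}"
    using assms by (rule open_triangleE)
  show "open T" "convex T" "T \<noteq> {}" "compact (closure T)"
    using T by (simp_all add: finite_imp_compact_convex_hull)
  from compact_imp_bounded[OF \<open>compact (closure T)\<close>] show "bounded T"
    by (rule bounded_subset) (rule closure_subset)
qed

lemma affine_comb_3:
  fixes g :: "'a::real_inner"
  assumes "u + v + w = 1"
  shows "g \<bullet> (u *\<^sub>R a + v *\<^sub>R b + w *\<^sub>R c) + k = u * (g \<bullet> a + k) + v * (g \<bullet> b + k) + w * (g \<bullet> c + k)"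
proof -
  have "k = (u + v + w) * k" using assms by simp
  then have "g \<bullet> (u *\<^sub>R a + v *\<^sub>R b + w *\<^sub>R c) + k
     = g \<bullet> (u *\<^sub>R a + v *\<^sub>R b + w *\<^sub>R c) + (u + v + w) * k" by simp
  then show ?thesis by (simp add: algebra_simps)
qed

text \<open>
  The three affine functions are the barycentric coordinates. They present the open triangle as an
  intersection of open half planes, the form in which cutoff functions can be written down.
\<close>

lemma open_triangle_barycentric:
  assumes "open_triangle T"
  obtains g1 k1 g2 k2 g3 k3 where
    "T = {x. 0 < g1 \<bullet> x + k1 \<and> 0 < g2 \<bullet> x + k2 \<and> 0 < g3 \<bullet> x + k3}"
proof -
  obtain a b c where abc: "\<not> collinear {a,b,c}" and T: "T = interior (convex hull {a,b,c})"
    and d: "a \<noteq> b" "b \<noteq> c" "a \<noteq> c"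
    using assms by (rule open_triangleE)
  have ai: "\<not> affine_dependent {a,b,c}" using abc affine_dependent_imp_collinear_3 by blast
  have DIM2: "DIM(real^2) = 2" by simp
  have U: "affine hull {a,b,c} = UNIV"
    using affine_independent_span_eq[OF ai] d by simp
  obtain g1 k1 where 1: "g1 \<bullet> a + k1 = 1" "g1 \<bullet> b + k1 = 0" "g1 \<bullet> c + k1 = 0"
    using affine_interpolation[OF abc] by blast
  obtain g2 k2 where 2: "g2 \<bullet> a + k2 = 0" "g2 \<bullet> b + k2 = 1" "g2 \<bullet> c + k2 = 0"
    using affine_interpolation[OF abc] by blast
  obtain g3 k3 where 3: "g3 \<bullet> a + k3 = 0" "g3 \<bullet> b + k3 = 0" "g3 \<bullet> c + k3 = 1"
    using affine_interpolation[OF abc] by blast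
  have bary: "g1 \<bullet> (u *\<^sub>R a + v *\<^sub>R b + w *\<^sub>R c) + k1 = u"
     "g2 \<bullet> (u *\<^sub>R a + v *\<^sub>R b + w *\<^sub>R c) + k2 = v"
     "g3 \<bullet> (u *\<^sub>R a + v *\<^sub>R b + w *\<^sub>R c) + k3 = w" if "u + v + w = 1" for u v w
    unfolding affine_comb_3[OF that] 1 2 3 by simp_all
  have "x \<in> T \<longleftrightarrow> 0 < g1 \<bullet> x + k1 \<and> 0 < g2 \<bullet> x + k2 \<and> 0 < g3 \<bullet> x + k3" for x
  proof -
    have "x \<in> affine hull {a,b,c}" using U by simp
    then obtain u v w where x: "x = u *\<^sub>R a + v *\<^sub>R b + w *\<^sub>R c" and s: "u + v + w = 1"
      unfolding affine_hull_3 by blast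
    note bx = bary[OF s, folded x]
    have "x \<in> T \<longleftrightarrow> (\<exists>u v w. 0 < u \<and> 0 < v \<and> 0 < w \<and> u + v + w = 1 \<and> u *\<^sub>R a + v *\<^sub>R b + w *\<^sub>R c = x)"
      unfolding T interior_convex_hull_3_minimal[OF abc DIM2] by (simp only: mem_Collect_eq)
    moreover have "(\<exists>u v w. 0 < u \<and> 0 < v \<and> 0 < w \<and> u + v + w = 1 \<and> u *\<^sub>R a + v *\<^sub>R b + w *\<^sub>R c = x)
        \<longleftrightarrow> 0 < u \<and> 0 < v \<and> 0 < w" (is "?L \<longleftrightarrow> ?R")
    proof
      assume ?L
      then obtain u' v' w' where pos: "0 < u'" "0 < v'" "0 < w'" and s': "u' + v' + w' = 1"
        and x': "u' *\<^sub>R a + v' *\<^sub>R b + w' *\<^sub>R c = x" by blast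
      show ?R using pos bary[OF s'] bx unfolding x' by simp
    next
      assume ?R
      with s x[symmetric] show ?L by blast
    qed
    ultimately show ?thesis unfolding bx by blast
  qed
  then have "T = {x. 0 < g1 \<bullet> x + k1 \<and> 0 < g2 \<bullet> x + k2 \<and> 0 < g3 \<bullet> x + k3}" by auto
  then show thesis by (rule that)
qed

section \<open>Piecewise affine functions on a triangulated domain\<close>

definition grad :: "(real^2 \<Rightarrow> real) \<Rightarrow> (real^2) set \<Rightarrow> real^2" where
  "grad u T = (SOME a. \<exists>c. \<forall>x\<in>T. u x = a \<bullet> x + c)"

lemma grad_eqI:
  assumes "open T" "T \<noteq> {}" "\<exists>c. \<forall>x\<in>T. u x = a \<bullet> x + c"
  shows "grad u T = a"
  unfolding grad_def
proof (rule some_equality)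
  obtain c where c: "\<And>x. x \<in> T \<Longrightarrow> u x = a \<bullet> x + c" using assms(3) by blast
  show "\<exists>c. \<forall>x\<in>T. u x = a \<bullet> x + c" by (fact assms(3))
  fix a' assume "\<exists>c. \<forall>x\<in>T. u x = a' \<bullet> x + c"
  then obtain c' where "\<And>x. x \<in> T \<Longrightarrow> u x = a' \<bullet> x + c'" by blast
  with c show "a' = a"
    by (intro affine_function_eq_on_open(1)[OF assms(1,2), of a' c' a c]) simp
qed

locale triangulated_domain =
  fixes \<Omega> :: "(real^2) set" and \<T> :: "(real^2) set set"
  assumes open_domain: "open \<Omega>" and bounded_domain: "bounded \<Omega>"
    and connected_domain: "connected \<Omega>" and triangulation: "triangulation_of \<Omega> \<T>"
begin

lemma finite_triangles: "finite \<T>"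
  using triangulation by (simp add: triangulation_of_def)

lemma triangle:
  assumes "T \<in> \<T>"
  shows "open_triangle T" "T \<subseteq> \<Omega>" "open T" "T \<noteq> {}" "convex T" "bounded T" "compact (closure T)"
proof -
  show T: "open_triangle T" "T \<subseteq> \<Omega>" using assms triangulation by (auto simp: triangulation_of_def)
  show "open T" "T \<noteq> {}" "convex T" "bounded T" "compact (closure T)"
    by (fact open_triangle_basic[OF T(1)])+
qed

lemma triangles_eqI: "T \<in> \<T> \<Longrightarrow> T' \<in> \<T> \<Longrightarrow> x \<in> T \<Longrightarrow> x \<in> T' \<Longrightarrow> T = T'"
proof (rule ccontr)
  assume *: "T \<in> \<T>" "T' \<in> \<T>" "x \<in> T" "x \<in> T'" "T \<noteq> T'"
  have "pairwise disjnt \<T>" using triangulation by (simp add: triangulation_of_def)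
  then have "disjnt T T'" using * by (simp add: pairwise_def)
  with * show False by (simp add: disjnt_iff)
qed

lemma triangles_cover: "closure \<Omega> \<subseteq> (\<Union>T\<in>\<T>. closure T)"
  using triangulation by (simp add: triangulation_of_def)

lemma in_closed_triangle:
  assumes "x \<in> \<Omega>"
  obtains T where "T \<in> \<T>" "x \<in> closure T"
  using assms triangles_cover closure_subset[of \<Omega>] by blast

lemma conforming_cases:
  assumes "T \<in> \<T>" "T' \<in> \<T>" "T \<noteq> T'" "x \<in> closure T" "x \<in> closure T'"
  obtains v w where "v \<in> vertices T" "v \<in> vertices T'" "w \<in> vertices T" "w \<in> vertices T'"
    "x \<in> closed_segment v w" "closed_segment v w \<subseteq> closure T"
proof -
  have "(\<exists>v \<in> vertices T \<inter> vertices T'. closure T \<inter> closure T' = {v}) \<or>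
        (\<exists>v \<in> vertices T \<inter> vertices T'. \<exists>w \<in> vertices T \<inter> vertices T'.
            v \<noteq> w \<and> closure T \<inter> closure T' = closed_segment v w)"
  proof -
    have "\<forall>T\<in>\<T>. \<forall>T'\<in>\<T>. T \<noteq> T' \<longrightarrow> closure T \<inter> closure T' = {} \<or>
        (\<exists>v \<in> vertices T \<inter> vertices T'. closure T \<inter> closure T' = {v}) \<or>
        (\<exists>v \<in> vertices T \<inter> vertices T'. \<exists>w \<in> vertices T \<inter> vertices T'.
            v \<noteq> w \<and> closure T \<inter> closure T' = closed_segment v w)"
      using triangulation by (simp add: triangulation_of_def)
    from this[rule_format, OF assms(1-3)] assms(4,5) show ?thesis by (elim disjE) auto
  qed
  then show thesis
  proof (elim disjE bexE conjE)
    fix v assume "v \<in> vertices T \<inter> vertices T'" "closure T \<inter> closure T' = {v}"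
    with assms(4,5) that[of v v] show thesis by auto
  next
    fix v w assume "v \<in> vertices T \<inter> vertices T'" "w \<in> vertices T \<inter> vertices T'"
      "closure T \<inter> closure T' = closed_segment v w"
    with assms(4,5) that[of v w] show thesis by blast
  qed
qed

text \<open>
  In a conforming triangulation no vertex lies in the relative interior of an edge: the point \<open>z\<close>
  lies on a segment between common vertices, and as an extreme point of \<open>closure T0\<close> it
  must be an end point of it.
\<close>

lemma vertex_of_incident_triangle:
  assumes "T0 \<in> \<T>" "z \<in> vertices T0" "T \<in> \<T>" "z \<in> closure T"
  shows "z \<in> vertices T"
proof (cases "T = T0")
  case False
  have ext: "z extreme_point_of closure T0" using assms(2) by (simp add: vertices_def)
  then have "z \<in> closure T0" by (simp add: extreme_point_of_def)
  with assms False obtain v w where vw: "v \<in> vertices T" "w \<in> vertices T"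
    "z \<in> closed_segment v w" "closed_segment v w \<subseteq> closure T0"
    using conforming_cases[of T0 T z] by metis
  have "v \<in> closure T0" "w \<in> closure T0" using vw(4) by auto
  with ext have "z \<notin> open_segment v w" by (auto simp: extreme_point_of_def)
  with vw show ?thesis by (auto simp: open_segment_def)
qed (use assms in simp)

text \<open>
  Only points of \<open>\<Omega>\<close> are covered: on the boundary of \<open>\<Omega>\<close> the extension by zero usually breaks the
  affine formula.
\<close>

lemma P1_affine_on_closed_triangle:
  assumes "u \<in> P1 \<Omega> \<T>" "T \<in> \<T>"
  shows "\<exists>c. \<forall>x\<in>closure T \<inter> \<Omega>. u x = grad u T \<bullet> x + c"
proof -
  obtain a c where ac: "\<And>x. x \<in> T \<Longrightarrow> u x = a \<bullet> x + c" using assms unfolding P1_def by blast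
  have a: "grad u T = a"
    by (rule grad_eqI[OF triangle(3,4)[OF assms(2)]]) (use ac in blast)
  have "continuous_on \<Omega> (\<lambda>x. u x - (a \<bullet> x + c))"
    using assms(1) by (auto simp: P1_def intro!: continuous_intros)
  then have "closedin (top_of_set \<Omega>) {x \<in> \<Omega>. u x - (a \<bullet> x + c) = 0}"
    by (rule continuous_closedin_preimage_constant)
  then obtain C where C: "closed C" "{x \<in> \<Omega>. u x - (a \<bullet> x + c) = 0} = \<Omega> \<inter> C"
    unfolding closedin_closed by blast
  have "T \<subseteq> C" using ac C(2) triangle(2)[OF assms(2)] by auto
  then have "closure T \<subseteq> C" using C(1) by (rule closure_minimal)
  then have "u x = a \<bullet> x + c" if "x \<in> closure T" "x \<in> \<Omega>" for x
    using that C(2) by auto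
  then show ?thesis using a by blast
qed

lemma P1_zero_outside: "u \<in> P1 \<Omega> \<T> \<Longrightarrow> x \<notin> \<Omega> \<Longrightarrow> u x = 0"
  by (simp add: P1_def)

lemma P1_continuous: "u \<in> P1 \<Omega> \<T> \<Longrightarrow> continuous_on \<Omega> u"
  by (simp add: P1_def)

lemma P1_linear_combination:
  assumes "u \<in> P1 \<Omega> \<T>" "v \<in> P1 \<Omega> \<T>"
  shows "(\<lambda>x. r * u x + s * v x) \<in> P1 \<Omega> \<T>"
    and "T \<in> \<T> \<Longrightarrow> grad (\<lambda>x. r * u x + s * v x) T = r *\<^sub>R grad u T + s *\<^sub>R grad v T"
proof -
  have *: "\<exists>c. \<forall>x\<in>T. r * u x + s * v x = (r *\<^sub>R grad u T + s *\<^sub>R grad v T) \<bullet> x + c" if T: "T \<in> \<T>" for T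
  proof -
    obtain c where c: "\<And>x. x \<in> closure T \<Longrightarrow> x \<in> \<Omega> \<Longrightarrow> u x = grad u T \<bullet> x + c"
      using P1_affine_on_closed_triangle[OF assms(1) T] by blast
    obtain d where d: "\<And>x. x \<in> closure T \<Longrightarrow> x \<in> \<Omega> \<Longrightarrow> v x = grad v T \<bullet> x + d"
      using P1_affine_on_closed_triangle[OF assms(2) T] by blast
    have "x \<in> closure T" "x \<in> \<Omega>" if "x \<in> T" for x
      using that triangle(2)[OF T] closure_subset by auto
    then have "\<forall>x\<in>T. r * u x + s * v x = (r *\<^sub>R grad u T + s *\<^sub>R grad v T) \<bullet> x + (r * c + s * d)"
      using c d by (auto simp: algebra_simps)
    then show ?thesis by blast
  qed
  show "(\<lambda>x. r * u x + s * v x) \<in> P1 \<Omega> \<T>"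
    unfolding P1_def
  proof (intro CollectI conjI ballI allI impI)
    show "continuous_on \<Omega> (\<lambda>x. r * u x + s * v x)"
      by (intro continuous_intros P1_continuous assms)
    show "r * u x + s * v x = 0" if "x \<notin> \<Omega>" for x
      using that assms by (simp add: P1_zero_outside)
  qed (use * in blast)
  show "grad (\<lambda>x. r * u x + s * v x) T = r *\<^sub>R grad u T + s *\<^sub>R grad v T" if T: "T \<in> \<T>"
    by (rule grad_eqI[OF triangle(3,4)[OF T] *[OF T]])
qed

lemma P1_const:
  shows "(\<lambda>x. if x \<in> \<Omega> then c else 0) \<in> P1 \<Omega> \<T>"
    and "T \<in> \<T> \<Longrightarrow> grad (\<lambda>x. if x \<in> \<Omega> then c else 0) T = 0"
proof -
  show "(\<lambda>x. if x \<in> \<Omega> then c else 0) \<in> P1 \<Omega> \<T>"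
    unfolding P1_def
  proof (intro CollectI conjI ballI allI impI)
    show "continuous_on \<Omega> (\<lambda>x. if x \<in> \<Omega> then c else 0)"
      by (rule continuous_on_eq[OF continuous_on_const[of _ c]]) simp
    fix T assume "T \<in> \<T>"
    from triangle(2)[OF this] show "\<exists>a c'. \<forall>x\<in>T. (if x \<in> \<Omega> then c else 0) = a \<bullet> x + c'"
      by (intro exI[of _ 0] exI[of _ c]) auto
  qed simp
  show "grad (\<lambda>x. if x \<in> \<Omega> then c else 0) T = 0" if "T \<in> \<T>"
    using triangle(2,3,4)[OF that] by (intro grad_eqI exI[of _ c]) auto
qed

lemma P1_bounded:
  assumes "u \<in> P1 \<Omega> \<T>"
  shows "\<exists>M. \<forall>x. \<bar>u x\<bar> \<le> M"
proof -
  have "bounded (u ` (closure T \<inter> \<Omega>))" if T: "T \<in> \<T>" for T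
  proof -
    obtain c where c: "\<And>x. x \<in> closure T \<Longrightarrow> x \<in> \<Omega> \<Longrightarrow> u x = grad u T \<bullet> x + c"
      using P1_affine_on_closed_triangle[OF assms T] by blast
    have "compact ((\<lambda>x. grad u T \<bullet> x + c) ` closure T)"
      by (intro compact_continuous_image continuous_intros triangle(7)[OF T])
    then have "bounded ((\<lambda>x. grad u T \<bullet> x + c) ` closure T)" by (rule compact_imp_bounded)
    then show ?thesis by (rule bounded_subset) (use c in auto)
  qed
  then have "bounded (\<Union>T\<in>\<T>. u ` (closure T \<inter> \<Omega>))"
    using finite_triangles by auto
  moreover have "u ` \<Omega> \<subseteq> (\<Union>T\<in>\<T>. u ` (closure T \<inter> \<Omega>))"
  proof
    fix y assume "y \<in> u ` \<Omega>"
    then obtain x where x: "x \<in> \<Omega>" "y = u x" by blast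
    from in_closed_triangle[OF x(1)] obtain T where "T \<in> \<T>" "x \<in> closure T" .
    with x show "y \<in> (\<Union>T\<in>\<T>. u ` (closure T \<inter> \<Omega>))" by blast
  qed
  ultimately have "bounded (u ` \<Omega>)" by (rule bounded_subset)
  then obtain M where M: "\<And>x. x \<in> \<Omega> \<Longrightarrow> \<bar>u x\<bar> \<le> M" unfolding bounded_iff by auto
  have "\<bar>u x\<bar> \<le> max M 0" for x
    using M[of x] P1_zero_outside[OF assms, of x] by (cases "x \<in> \<Omega>") auto
  then show ?thesis by blast
qed

lemma P1_measurable:
  assumes "u \<in> P1 \<Omega> \<T>"
  shows "u \<in> borel_measurable borel"
proof -
  have "(\<lambda>x. indicator \<Omega> x *\<^sub>R u x) \<in> borel_measurable borel"
    using P1_continuous[OF assms] open_domain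
    by (intro borel_measurable_continuous_on_indicator) auto
  moreover have "(\<lambda>x. indicator \<Omega> x *\<^sub>R u x) = u"
    using P1_zero_outside[OF assms] by (auto simp: fun_eq_iff indicator_def)
  ultimately show ?thesis by simp
qed

lemma P1_integrable:
  assumes "u \<in> P1 \<Omega> \<T>"
  shows "integrable lborel u"
proof -
  obtain M where M: "\<And>x. \<bar>u x\<bar> \<le> M" using P1_bounded[OF assms] by blast
  have "integrable lborel (\<lambda>x. M * indicator \<Omega> x)"
    using open_domain emeasure_bounded_finite[OF bounded_domain]
    by (intro integrable_mult_right integrable_real_indicator) auto
  then show ?thesis
  proof (rule Bochner_Integration.integrable_bound)
    show "u \<in> borel_measurable lborel" using P1_measurable[OF assms] by simp
    show "AE x in lborel. norm (u x) \<le> norm (M * indicator \<Omega> x)"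
      using M P1_zero_outside[OF assms] by (intro AE_I2) (auto simp: indicator_def intro: order_trans[OF M])
  qed
qed

lemma P1_set_integral: "u \<in> P1 \<Omega> \<T> \<Longrightarrow> (LINT x:\<Omega>|lborel. u x) = (LINT x|lborel. u x)"
  unfolding set_lebesgue_integral_def
  by (rule Bochner_Integration.integral_cong) (auto simp: indicator_def P1_zero_outside)

text \<open>
  Such a function is constant on each triangle, so it takes finitely many values; being continuous
  on a connected set, it is constant.
\<close>

lemma P1_eq_const_if_grad_zero:
  assumes "u \<in> P1 \<Omega> \<T>" "\<And>T. T \<in> \<T> \<Longrightarrow> grad u T = 0"
  shows "\<exists>c. \<forall>x\<in>\<Omega>. u x = c"
proof -
  have "\<forall>T\<in>\<T>. \<exists>c. \<forall>x\<in>closure T \<inter> \<Omega>. u x = c"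
  proof
    fix T assume T: "T \<in> \<T>"
    obtain c where "\<And>x. x \<in> closure T \<Longrightarrow> x \<in> \<Omega> \<Longrightarrow> u x = grad u T \<bullet> x + c"
      using P1_affine_on_closed_triangle[OF assms(1) T] by blast
    with assms(2)[OF T] show "\<exists>c. \<forall>x\<in>closure T \<inter> \<Omega>. u x = c" by auto
  qed
  then obtain c where c: "\<And>T x. T \<in> \<T> \<Longrightarrow> x \<in> closure T \<Longrightarrow> x \<in> \<Omega> \<Longrightarrow> u x = c T"
    by (metis IntI)
  have "u ` \<Omega> \<subseteq> c ` \<T>"
    using c in_closed_triangle by (metis image_eqI image_subsetI)
  then have "finite (u ` \<Omega>)" using finite_triangles finite_surj by blast
  then have "u constant_on \<Omega>"
    by (rule continuous_finite_range_constant[OF connected_domain P1_continuous[OF assms(1)]])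
  then show ?thesis unfolding constant_on_def .
qed

text \<open>
  The affine interpolants on two triangles agree on the common part, which is spanned by common
  vertices; they can therefore be glued along the finite cover by closed triangles.
\<close>

lemma P1_nodal_interpolant:
  fixes w :: "real^2 \<Rightarrow> real"
  obtains u where "u \<in> P1 \<Omega> \<T>"
    "\<And>T. T \<in> \<T> \<Longrightarrow> \<exists>k. (\<forall>v\<in>vertices T. grad u T \<bullet> v + k = w v) \<and>
        (\<forall>x\<in>closure T \<inter> \<Omega>. u x = grad u T \<bullet> x + k)"
proof -
  have "\<forall>T\<in>\<T>. \<exists>p. \<forall>v\<in>vertices T. fst p \<bullet> v + snd p = w v"
  proof
    fix T assume "T \<in> \<T>"
    then obtain a b c where "\<not> collinear {a,b,c}" "vertices T = {a,b,c}"
      using open_triangleE[OF triangle(1)] by metis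
    with affine_interpolation[of a b c "w a" "w b" "w c"]
    show "\<exists>p. \<forall>v\<in>vertices T. fst p \<bullet> v + snd p = w v" by auto
  qed
  then obtain p where p: "\<And>T v. T \<in> \<T> \<Longrightarrow> v \<in> vertices T \<Longrightarrow> fst (p T) \<bullet> v + snd (p T) = w v"
    by metis
  define A where "A T x = fst (p T) \<bullet> x + snd (p T)" for T x
  have A: "A T v = w v" if "T \<in> \<T>" "v \<in> vertices T" for T v using p[OF that] by (simp add: A_def)
  have A_seg: "A T ((1 - s) *\<^sub>R v + s *\<^sub>R v') = (1 - s) * A T v + s * A T v'" for T s v v'
    by (simp add: A_def algebra_simps)
  have eq: "A T x = A T' x" if T: "T \<in> \<T>" "T' \<in> \<T>" "x \<in> closure T" "x \<in> closure T'" for T T' x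
  proof (cases "T = T'")
    case False
    obtain v v' where v: "v \<in> vertices T" "v \<in> vertices T'" "v' \<in> vertices T" "v' \<in> vertices T'"
      "x \<in> closed_segment v v'"
      using conforming_cases[OF T(1,2) False T(3,4)] .
    then obtain s where "x = (1 - s) *\<^sub>R v + s *\<^sub>R v'" unfolding closed_segment_def by blast
    with v A T show ?thesis by (simp add: A_seg)
  qed simp
  \<comment> \<open>Any triangle containing the point may be chosen, since the interpolants agree.\<close>
  define U where "U x = A (SOME T. T \<in> \<T> \<and> x \<in> closure T) x" for x
  have U: "U x = A T x" if "T \<in> \<T>" "x \<in> closure T" for T x
  proof -
    have "(SOME T. T \<in> \<T> \<and> x \<in> closure T) \<in> \<T> \<and> x \<in> closure (SOME T. T \<in> \<T> \<and> x \<in> closure T)"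
      using that by (intro someI[of "\<lambda>T. T \<in> \<T> \<and> x \<in> closure T"]) simp
    with that show ?thesis unfolding U_def by (intro eq) auto
  qed
  have "continuous_on (\<Union>T\<in>\<T>. closure T) U"
  proof (rule continuous_on_closed_Union[OF finite_triangles])
    fix T assume "T \<in> \<T>"
    with U have "\<And>x. x \<in> closure T \<Longrightarrow> A T x = U x" by simp
    moreover have "continuous_on (closure T) (A T)" unfolding A_def by (intro continuous_intros)
    ultimately show "continuous_on (closure T) U" by (rule continuous_on_eq[rotated])
  qed simp
  then have cont: "continuous_on \<Omega> U"
    by (rule continuous_on_subset) (use triangles_cover closure_subset[of \<Omega>] in blast)
  define u where "u x = (if x \<in> \<Omega> then U x else 0)" for x
  have u: "u x = A T x" if "T \<in> \<T>" "x \<in> closure T" "x \<in> \<Omega>" for T x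
    using U[OF that(1,2)] that(3) by (simp add: u_def)
  have uT: "u x = fst (p T) \<bullet> x + snd (p T)" if "T \<in> \<T>" "x \<in> T" for T x
    using u[OF that(1)] that closure_subset[of T] triangle(2)[OF that(1)] unfolding A_def by blast
  have g: "grad u T = fst (p T)" if "T \<in> \<T>" for T
    by (rule grad_eqI[OF triangle(3,4)[OF that]]) (use uT[OF that] in blast)
  have "u \<in> P1 \<Omega> \<T>" unfolding P1_def
  proof (intro CollectI conjI ballI allI impI)
    show "continuous_on \<Omega> u" by (rule continuous_on_eq[OF cont]) (simp add: u_def)
    show "\<exists>a c. \<forall>x\<in>T. u x = a \<bullet> x + c" if "T \<in> \<T>" for T using uT[OF that] by blast
  qed (simp add: u_def)
  moreover have "\<exists>k. (\<forall>v\<in>vertices T. grad u T \<bullet> v + k = w v) \<and>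
        (\<forall>x\<in>closure T \<inter> \<Omega>. u x = grad u T \<bullet> x + k)" if "T \<in> \<T>" for T
    using p[OF that] u[OF that] by (intro exI[of _ "snd (p T)"]) (auto simp: g[OF that] A_def)
  ultimately show thesis by (rule that)
qed

end

section \<open>Lipschitz functions, translation invariance and test fields\<close>

text \<open>
  Restricted to a segment, this is the statement for finite closed covers of an interval. The
  constant does not deteriorate, whatever the shape of the pieces.
\<close>

lemma lipschitz_on_finite_closed_cover:
  fixes F :: "'a::real_normed_vector \<Rightarrow> 'b::metric_space"
  assumes "finite I" "\<And>C. C \<in> I \<Longrightarrow> closed C" "\<And>C. C \<in> I \<Longrightarrow> L-lipschitz_on C F"
    and "\<Union>I = UNIV" and "L \<ge> 0"
  shows "L-lipschitz_on UNIV F"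
proof (rule lipschitz_onI)
  fix x y :: 'a
  define \<gamma> where "\<gamma> s = x + s *\<^sub>R (y - x)" for s :: real
  have \<gamma>: "dist (\<gamma> s) (\<gamma> t) = norm (y - x) * dist s t" for s t
  proof -
    have "\<gamma> s - \<gamma> t = (s - t) *\<^sub>R (y - x)" by (simp add: \<gamma>_def algebra_simps)
    then show ?thesis by (simp add: dist_norm)
  qed
  have "(L * norm (y - x))-lipschitz_on {0..1} (F \<circ> \<gamma>)"
  proof (rule lipschitz_on_closed_Union[where I = I and U = "\<lambda>C. \<gamma> -` C"])
    fix C assume C: "C \<in> I"
    show "(L * norm (y - x))-lipschitz_on (\<gamma> -` C) (F \<circ> \<gamma>)"
    proof (rule lipschitz_onI)
      fix s t assume "s \<in> \<gamma> -` C" "t \<in> \<gamma> -` C"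
      then have "dist (F (\<gamma> s)) (F (\<gamma> t)) \<le> L * dist (\<gamma> s) (\<gamma> t)"
        using lipschitz_onD[OF assms(3)[OF C]] by simp
      then show "dist ((F \<circ> \<gamma>) s) ((F \<circ> \<gamma>) t) \<le> L * norm (y - x) * dist s t"
        by (simp add: \<gamma> mult.assoc)
    qed (use assms in simp)
    show "closed (\<gamma> -` C)"
      by (rule closed_vimage[OF assms(2)[OF C]]) (auto simp: \<gamma>_def intro!: continuous_intros)
  qed (use assms in \<open>auto simp: vimage_Union[symmetric]\<close>)
  from lipschitz_onD[OF this, of 0 1] show "dist (F x) (F y) \<le> L * dist x y"
    by (simp add: \<gamma>_def dist_norm norm_minus_commute)
qed (fact assms)

lemma integrable_continuous_compact_support:
  fixes f :: "'a::euclidean_space \<Rightarrow> real"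
  assumes "continuous_on UNIV f" "compact K" "\<And>x. x \<notin> K \<Longrightarrow> f x = 0"
  shows "integrable lborel f"
proof -
  have "integrable lborel (\<lambda>x. indicator K x *\<^sub>R f x)"
    by (intro borel_integrable_compact assms continuous_on_subset[OF assms(1)]) simp
  moreover have "(\<lambda>x. indicator K x *\<^sub>R f x) = f"
    using assms(3) by (auto simp: fun_eq_iff indicator_def)
  ultimately show ?thesis by simp
qed

lemma integrable_bounded_mult_compact_support:
  fixes f g :: "'a::euclidean_space \<Rightarrow> real"
  assumes "continuous_on UNIV f" "compact K" "\<And>x. x \<notin> K \<Longrightarrow> f x = 0"
    and [measurable]: "g \<in> borel_measurable borel" and M: "\<And>x. \<bar>g x\<bar> \<le> M"
  shows "integrable lborel (\<lambda>x. g x * f x)"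
proof -
  have [measurable]: "f \<in> borel_measurable borel"
    using assms(1) by (rule borel_measurable_continuous_onI)
  have "integrable lborel (\<lambda>x. M * f x)"
    using integrable_continuous_compact_support[OF assms(1-3)] by simp
  then show ?thesis
  proof (rule Bochner_Integration.integrable_bound)
    show "AE x in lborel. norm (g x * f x) \<le> norm (M * f x)"
    proof (intro AE_I2)
      fix x show "norm (g x * f x) \<le> norm (M * f x)"
        using M[of x] by (auto simp: abs_mult intro!: mult_right_mono)
    qed
  qed measurable
qed

text \<open>
  By translation invariance every difference quotient of \<open>F\<close> has integral zero. The Lipschitz bound and
  the bounded support give a dominating function, so the integral of the limit is zero as well. An
  exceptional null set for the derivative does no harm, which is what makes the argument fit
  piecewise smooth functions.
\<close>

lemma integral_directional_derivative_eq_0: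
  fixes F :: "'a::euclidean_space \<Rightarrow> real"
  assumes L: "L-lipschitz_on UNIV F" and supp: "\<And>x. norm x \<ge> R \<Longrightarrow> F x = 0"
    and [measurable]: "G \<in> borel_measurable borel"
    and deriv: "AE x in lborel. ((\<lambda>h. F (x + h *\<^sub>R e)) has_real_derivative G x) (at 0)"
  shows "integral\<^sup>L lborel G = 0"
proof -
  define h where "h n = inverse (real (Suc n))" for n
  have h: "h n > 0" "h n \<le> 1" for n by (auto simp: h_def field_simps)
  have cont: "continuous_on UNIV F" by (rule lipschitz_on_continuous_on[OF L])
  have [measurable]: "F \<in> borel_measurable borel"
    using cont by (rule borel_measurable_continuous_onI)
  have intF: "integrable lborel F"
    by (rule integrable_continuous_compact_support[OF cont compact_cball[of 0 R]]) (auto intro: supp)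
  have shift: "integrable lborel (\<lambda>x. F (x + v)) \<and> (LINT x|lborel. F (x + v)) = (LINT x|lborel. F x)" for v
  proof -
    have "integrable (distr lborel borel ((+) v)) F" using intF by (simp only: lborel_distr_plus)
    then have "integrable lborel (\<lambda>x. F (v + x))" by (subst (asm) integrable_distr_eq) auto
    moreover have "(LINT x|lborel. F x) = (LINT x|distr lborel borel ((+) v). F x)"
      by (simp only: lborel_distr_plus)
    moreover have "\<dots> = (LINT x|lborel. F (v + x))" by (rule integral_distr) auto
    ultimately show ?thesis by (simp add: add.commute)
  qed
  define s where "s n x = (F (x + h n *\<^sub>R e) - F x) / h n" for n x
  \<comment> \<open>The steps have length at most \<open>norm e\<close>, so enlarging the support by that radius suffices.\<close>
  define w where "w x = L * norm e * indicator (cball 0 (R + norm e)) x" for x :: 'a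
  have "L \<ge> 0" using L by (rule lipschitz_on_nonneg)
  have "(\<lambda>n. integral\<^sup>L lborel (s n)) \<longlonglongrightarrow> integral\<^sup>L lborel G"
  proof (rule integral_dominated_convergence[where w = w])
    show "G \<in> borel_measurable lborel" by measurable
    show "s n \<in> borel_measurable lborel" for n unfolding s_def by measurable
    have "emeasure lborel (cball (0::'a) (R + norm e)) < \<infinity>"
      by (rule emeasure_bounded_finite) simp
    then show "integrable lborel w" unfolding w_def
      by (intro integrable_mult_right integrable_real_indicator) auto
    show "AE x in lborel. (\<lambda>n. s n x) \<longlonglongrightarrow> G x"
      using deriv
    proof (eventually_elim)
      fix x assume "((\<lambda>h. F (x + h *\<^sub>R e)) has_real_derivative G x) (at 0)"
      then have "((\<lambda>k. (F (x + k *\<^sub>R e) - F x) / k) \<longlongrightarrow> G x) (at 0)"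
        by (simp add: DERIV_def)
      moreover have "filterlim h (at 0) sequentially"
        using LIMSEQ_inverse_real_of_nat h(1) unfolding h_def
        by (intro filterlim_atI) (auto simp: less_imp_neq)
      ultimately show "(\<lambda>n. s n x) \<longlonglongrightarrow> G x" unfolding s_def by (rule filterlim_compose)
    qed
    show "AE x in lborel. norm (s n x) \<le> w x" for n
    proof (intro AE_I2)
      fix x
      have "\<bar>F (x + h n *\<^sub>R e) - F x\<bar> \<le> L * (norm e * h n)"
        using lipschitz_onD[OF L, of "x + h n *\<^sub>R e" x] h[of n] by (simp add: dist_norm mult.commute)
      then have 1: "norm (s n x) \<le> L * norm e" using h(1)[of n] by (simp add: s_def field_simps)
      show "norm (s n x) \<le> w x"
      proof (cases "norm x \<le> R + norm e")
        case True then show ?thesis using 1 by (simp add: w_def)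
      next
        case False
        have "norm (h n *\<^sub>R e) \<le> norm e" using h[of n] by (simp add: mult_left_le_one_le)
        then have "norm (x + h n *\<^sub>R e) \<ge> R" "norm x \<ge> R"
          using False norm_diff_ineq[of x "h n *\<^sub>R e"] norm_ge_zero[of e] by linarith+
        then show ?thesis using supp \<open>L \<ge> 0\<close> by (simp add: s_def w_def)
      qed
    qed
  qed
  moreover have "integral\<^sup>L lborel (s n) = 0" for n
    using shift[of "h n *\<^sub>R e"] intF by (simp add: s_def[abs_def])
  ultimately show ?thesis by (simp add: LIMSEQ_const_iff)
qed

lemma C1c_has_derivative:
  "\<psi> \<in> C1c \<Omega> \<Longrightarrow> (\<psi> has_derivative frechet_derivative \<psi> (at x)) (at x)"
  by (simp add: C1c_def frechet_derivative_works)

lemma C1c_continuous: "\<psi> \<in> C1c \<Omega> \<Longrightarrow> continuous_on S \<psi>"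
  by (intro continuous_at_imp_continuous_on ballI has_derivative_continuous[OF C1c_has_derivative])

lemma C1c_support:
  assumes "\<psi> \<in> C1c \<Omega>"
  obtains K where "compact K" "K \<subseteq> \<Omega>" "\<And>x. x \<notin> K \<Longrightarrow> \<psi> x = 0"
    "\<And>x v. x \<notin> K \<Longrightarrow> frechet_derivative \<psi> (at x) v = 0"
proof -
  obtain K where K: "compact K" "K \<subseteq> \<Omega>" "\<And>x. x \<notin> K \<Longrightarrow> \<psi> x = 0"
    using assms unfolding C1c_def by blast
  have "frechet_derivative \<psi> (at x) v = 0" if x: "x \<notin> K" for x v
  proof -
    have "open (- K)" using K(1) by (simp add: compact_imp_closed open_Compl)
    then have "(\<psi> has_derivative (\<lambda>_. 0)) (at x)"
      using x K(3) by (intro has_derivative_transform_within_open[OF has_derivative_const[of 0]]) auto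
    from frechet_derivative_at[OF this] show ?thesis by metis
  qed
  with K that show thesis by blast
qed

lemma C1c_derivative_continuous:
  "\<psi> \<in> C1c \<Omega> \<Longrightarrow> continuous_on UNIV (\<lambda>x. frechet_derivative \<psi> (at x) v)"
  by (simp add: C1c_def)

lemma bounded_continuous_compact_support:
  fixes f :: "'a::metric_space \<Rightarrow> 'b::real_normed_vector"
  assumes "continuous_on UNIV f" "compact K" "\<And>x. x \<notin> K \<Longrightarrow> f x = 0"
  shows "\<exists>B. \<forall>x. norm (f x) \<le> B"
proof -
  have "bounded (f ` K)"
    using assms by (intro compact_imp_bounded compact_continuous_image continuous_on_subset[OF assms(1)]) auto
  then obtain B where B: "\<And>x. x \<in> K \<Longrightarrow> norm (f x) \<le> B" unfolding bounded_iff by auto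
  have "norm (f x) \<le> max B 0" for x
    using B[of x] assms(3)[of x] by (cases "x \<in> K") auto
  then show ?thesis by blast
qed

text \<open>
  The partial derivatives are continuous with compact support, hence bounded, and they control the
  operator norm of the derivative.
\<close>

lemma C1c_lipschitz:
  assumes "\<psi> \<in> C1c \<Omega>"
  shows "\<exists>L. L-lipschitz_on UNIV \<psi>"
proof -
  obtain K where K: "compact K" "\<And>x v. x \<notin> K \<Longrightarrow> frechet_derivative \<psi> (at x) v = 0"
    using C1c_support[OF assms] by metis
  have "\<forall>b. \<exists>B. \<forall>x. norm (frechet_derivative \<psi> (at x) b) \<le> B"
    using bounded_continuous_compact_support[OF C1c_derivative_continuous[OF assms] K] by blast
  then obtain B where B: "\<And>x b. norm (frechet_derivative \<psi> (at x) b) \<le> B b" by metis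
  have B0: "B b \<ge> 0" for b using B[of 0 b] norm_ge_zero order_trans by blast
  have "(\<Sum>b\<in>Basis. B b)-lipschitz_on UNIV \<psi>"
  proof (rule bounded_derivative_imp_lipschitz)
    fix x show "(\<psi> has_derivative frechet_derivative \<psi> (at x)) (at x within UNIV)"
      using C1c_has_derivative[OF assms] by simp
    show "onorm (frechet_derivative \<psi> (at x)) \<le> (\<Sum>b\<in>Basis. B b)"
    proof (rule onorm_le)
      fix v
      have lin: "linear (frechet_derivative \<psi> (at x))"
        using C1c_has_derivative[OF assms] has_derivative_linear by blast
      have "frechet_derivative \<psi> (at x) v = frechet_derivative \<psi> (at x) (\<Sum>b\<in>Basis. (v \<bullet> b) *\<^sub>R b)"
        by (simp add: euclidean_representation)
      also have "\<dots> = (\<Sum>b\<in>Basis. (v \<bullet> b) *\<^sub>R frechet_derivative \<psi> (at x) b)"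
        by (simp add: linear_sum[OF lin] linear_scale[OF lin])
      also have "norm \<dots> \<le> (\<Sum>b\<in>Basis. norm v * B b)"
        using B B0 by (intro sum_norm_le) (auto intro!: mult_mono Basis_le_norm)
      finally show "norm (frechet_derivative \<psi> (at x) v) \<le> (\<Sum>b\<in>Basis. B b) * norm v"
        by (simp add: sum_distrib_left mult.commute)
    qed
  qed (auto intro: sum_nonneg B0)
  then show ?thesis by blast
qed

section \<open>Integration by parts\<close>

context triangulated_domain
begin

definition pw_grad :: "(real^2 \<Rightarrow> real) \<Rightarrow> real^2 \<Rightarrow> real^2" where
  "pw_grad u x = (\<Sum>T\<in>\<T>. indicator T x *\<^sub>R grad u T)"

definition energy :: "(real^2 \<Rightarrow> real) \<Rightarrow> real" where
  "energy u = (\<Sum>T\<in>\<T>. measure lborel T * norm (grad u T))"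

lemma sum_indicator_triangles:
  fixes f :: "(real^2) set \<Rightarrow> 'b::real_vector"
  assumes "T \<in> \<T>" "x \<in> T"
  shows "(\<Sum>T'\<in>\<T>. indicator T' x *\<^sub>R f T') = f T"
proof -
  have "(\<Sum>T'\<in>\<T>. indicator T' x *\<^sub>R f T') = (\<Sum>T'\<in>\<T>. if T' = T then f T else 0)"
    using assms triangles_eqI by (intro sum.cong) (auto simp: indicator_def)
  also have "\<dots> = f T" using assms(1) finite_triangles by simp
  finally show ?thesis .
qed

lemma pw_grad_on_triangle: "T \<in> \<T> \<Longrightarrow> x \<in> T \<Longrightarrow> pw_grad u x = grad u T"
  unfolding pw_grad_def by (rule sum_indicator_triangles)

lemma pw_grad_outside: "(\<And>T. T \<in> \<T> \<Longrightarrow> x \<notin> T) \<Longrightarrow> pw_grad u x = 0"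
  unfolding pw_grad_def by (rule sum.neutral) auto

lemma pw_grad_measurable: "(\<lambda>x. pw_grad u x $ i) \<in> borel_measurable borel"
  unfolding pw_grad_def
  by (simp only: sum_component vector_scaleR_component)
     (intro borel_measurable_sum borel_measurable_scaleR borel_measurable_indicator borel_measurable_const
        borel_open triangle(3))

lemma pw_grad_bounded: "\<exists>B. \<forall>x. \<bar>pw_grad u x $ i\<bar> \<le> B"
proof -
  have "\<bar>pw_grad u x $ i\<bar> \<le> (\<Sum>T\<in>\<T>. norm (grad u T))" for x
  proof -
    have "\<bar>pw_grad u x $ i\<bar> \<le> norm (pw_grad u x)" by (rule component_le_norm_cart)
    also have "\<dots> \<le> (\<Sum>T\<in>\<T>. norm (grad u T))"
      unfolding pw_grad_def by (intro sum_norm_le) (auto simp: indicator_def)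
    finally show ?thesis .
  qed
  then show ?thesis by blast
qed

lemma AE_off_frontiers: "AE x in lborel. \<forall>T\<in>\<T>. x \<notin> frontier T"
proof (rule AE_finite_allI[OF finite_triangles])
  fix T assume "T \<in> \<T>"
  then have "frontier T \<in> null_sets (completion lborel)"
    using negligible_convex_frontier[OF triangle(5)] by (simp add: negligible_iff_null_sets)
  then have "frontier T \<in> null_sets lborel"
    by (subst (asm) null_sets_completion_iff) simp_all
  then show "AE x in lborel. x \<notin> frontier T" by (rule AE_not_in)
qed

text \<open>
  The factor \<open>u\<close> itself may jump at the boundary of \<open>\<Omega>\<close>, but there \<open>\<psi>\<close> vanishes. So the product
  is continuous, is Lipschitz on every closed triangle, and is zero outside \<open>\<Omega>\<close>.
\<close>

lemma P1_mult_C1c_lipschitz: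
  assumes u: "u \<in> P1 \<Omega> \<T>" and \<psi>: "\<psi> \<in> C1c \<Omega>"
  shows "\<exists>L. L-lipschitz_on UNIV (\<lambda>x. u x * \<psi> x $ i)"
proof -
  define F where "F x = u x * \<psi> x $ i" for x
  obtain K where K: "compact K" "K \<subseteq> \<Omega>" "\<And>x. x \<notin> K \<Longrightarrow> \<psi> x = 0"
    using C1c_support[OF \<psi>] by metis
  obtain L where L: "L-lipschitz_on UNIV \<psi>" using C1c_lipschitz[OF \<psi>] by blast
  obtain B where B: "\<And>x. norm (\<psi> x) \<le> B"
    using bounded_continuous_compact_support[OF C1c_continuous[OF \<psi>] K(1,3)] by blast
  have L0: "L \<ge> 0" and B0: "B \<ge> 0"
    using L lipschitz_on_nonneg B[of 0] norm_ge_zero order_trans by blast+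
  have "\<forall>T\<in>\<T>. \<exists>M. M-lipschitz_on (closure T) F"
  proof
    fix T assume T: "T \<in> \<T>"
    obtain c where c: "\<And>x. x \<in> closure T \<Longrightarrow> x \<in> \<Omega> \<Longrightarrow> u x = grad u T \<bullet> x + c"
      using P1_affine_on_closed_triangle[OF u T] by blast
    \<comment> \<open>On the whole closed triangle \<open>u\<close> may be replaced by its affine formula, also at points
      outside \<open>\<Omega>\<close>, because \<open>\<psi>\<close> vanishes there.\<close>
    define A where "A x = grad u T \<bullet> x + c" for x
    have FA: "F x = A x * \<psi> x $ i" if "x \<in> closure T" for x
    proof (cases "x \<in> \<Omega>")
      case True
      then show ?thesis using c[OF that] by (simp add: F_def A_def)
    next
      case False
      then have "\<psi> x = 0" using K(2) by (intro K(3)) auto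
      then show ?thesis by (simp add: F_def)
    qed
    have "compact (A ` closure T)" unfolding A_def
      by (intro compact_continuous_image continuous_intros triangle(7)[OF T])
    then have "bounded (A ` closure T)" by (rule compact_imp_bounded)
    then obtain M where M: "\<And>x. x \<in> closure T \<Longrightarrow> \<bar>A x\<bar> \<le> M" unfolding bounded_iff by auto
    have "M \<ge> 0" using M triangle(4)[OF T] closure_subset[of T] abs_ge_zero order_trans by blast
    have "(M * L + norm (grad u T) * B)-lipschitz_on (closure T) F"
    proof (rule lipschitz_onI)
      fix x y assume xy: "x \<in> closure T" "y \<in> closure T"
      have "\<bar>\<psi> x $ i - \<psi> y $ i\<bar> \<le> norm (\<psi> x - \<psi> y)"
        using component_le_norm_cart[of "\<psi> x - \<psi> y" i] by simp
      also have "\<dots> \<le> L * norm (x - y)"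
        using lipschitz_onD[OF L, of x y] by (simp add: dist_norm)
      finally have 1: "\<bar>A x\<bar> * \<bar>\<psi> x $ i - \<psi> y $ i\<bar> \<le> M * (L * norm (x - y))"
        using M[OF xy(1)] \<open>M \<ge> 0\<close> by (intro mult_mono) auto
      have "\<bar>A x - A y\<bar> \<le> norm (grad u T) * norm (x - y)"
        using Cauchy_Schwarz_ineq2[of "grad u T" "x - y"] by (simp add: A_def inner_diff_right)
      moreover have "\<bar>\<psi> y $ i\<bar> \<le> B" using component_le_norm_cart[of "\<psi> y" i] B[of y] by linarith
      ultimately have 2: "\<bar>A x - A y\<bar> * \<bar>\<psi> y $ i\<bar> \<le> (norm (grad u T) * norm (x - y)) * B"
        by (intro mult_mono) auto
      have "F x - F y = A x * (\<psi> x $ i - \<psi> y $ i) + (A x - A y) * \<psi> y $ i"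
        by (simp add: FA xy algebra_simps)
      then have "\<bar>F x - F y\<bar> \<le> \<bar>A x\<bar> * \<bar>\<psi> x $ i - \<psi> y $ i\<bar> + \<bar>A x - A y\<bar> * \<bar>\<psi> y $ i\<bar>"
        using abs_triangle_ineq[of "A x * (\<psi> x $ i - \<psi> y $ i)" "(A x - A y) * \<psi> y $ i"]
        by (simp add: abs_mult)
      with 1 2 show "dist (F x) (F y) \<le> (M * L + norm (grad u T) * B) * dist x y"
        by (simp add: dist_norm algebra_simps)
    qed (simp add: \<open>M \<ge> 0\<close> L0 B0)
    then show "\<exists>M. M-lipschitz_on (closure T) F" by blast
  qed
  then obtain M where M: "\<And>T. T \<in> \<T> \<Longrightarrow> (M T)-lipschitz_on (closure T) F" by metis
  have M0: "M T \<ge> 0" if "T \<in> \<T>" for T using lipschitz_on_nonneg[OF M[OF that]] .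
  have cont: "continuous_on UNIV F"
  proof -
    have "continuous_on \<Omega> F" unfolding F_def
      by (intro continuous_intros P1_continuous[OF u] C1c_continuous[OF \<psi>])
    moreover have "continuous_on (- K) F"
      by (rule continuous_on_eq[OF continuous_on_const[of _ 0]]) (simp add: F_def K(3))
    moreover have "open (- K)" using K(1) by (simp add: compact_imp_closed open_Compl)
    ultimately have "continuous_on (\<Omega> \<union> - K) F"
      by (intro continuous_on_open_Un open_domain)
    moreover have "\<Omega> \<union> - K = UNIV" using K(2) by auto
    ultimately show ?thesis by simp
  qed
  \<comment> \<open>The closed triangles cover only the closure of \<open>\<Omega>\<close>; the zero set of \<open>F\<close> covers the rest
    of the plane and is closed because \<open>F\<close> is continuous.\<close>
  define Z where "Z = {x. F x = 0}"
  have "(sum M \<T>)-lipschitz_on UNIV F"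
  proof (rule lipschitz_on_finite_closed_cover[where I = "insert Z (closure ` \<T>)"])
    show "finite (insert Z (closure ` \<T>))" using finite_triangles by simp
    show "sum M \<T> \<ge> 0" using M0 by (rule sum_nonneg)
    have "closed Z"
      using continuous_closed_vimage[of "{0}" F] cont
      by (simp add: Z_def vimage_def continuous_on_eq_continuous_at)
    then show "closed C" if "C \<in> insert Z (closure ` \<T>)" for C using that by auto
    show "(sum M \<T>)-lipschitz_on C F" if "C \<in> insert Z (closure ` \<T>)" for C
    proof (cases "C = Z")
      case True
      then show ?thesis using \<open>sum M \<T> \<ge> 0\<close> by (auto simp: Z_def intro!: lipschitz_onI)
    next
      case False
      then obtain T where T: "T \<in> \<T>" "C = closure T" using \<open>C \<in> _\<close> by auto
      have "M T \<le> sum M \<T>" using T(1) M0 finite_triangles by (intro member_le_sum) auto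
      then show ?thesis using lipschitz_on_le[OF M[OF T(1)]] T(2) by simp
    qed
    show "\<Union> (insert Z (closure ` \<T>)) = UNIV"
    proof -
      have "x \<in> \<Union> (insert Z (closure ` \<T>))" for x
      proof (cases "x \<in> \<Omega>")
        case True
        then obtain T where "T \<in> \<T>" "x \<in> closure T" by (rule in_closed_triangle)
        then show ?thesis by auto
      qed (simp add: Z_def F_def P1_zero_outside[OF u])
      then show ?thesis by blast
    qed
  qed
  then show ?thesis unfolding F_def by blast
qed

text \<open>
  A point off all the frontiers lies in an open triangle, where \<open>u\<close> is affine, or outside the closure
  of \<open>\<Omega>\<close>, where everything vanishes.
\<close>

lemma P1_mult_C1c_derivative:
  assumes u: "u \<in> P1 \<Omega> \<T>" and \<psi>: "\<psi> \<in> C1c \<Omega>" and x: "\<forall>T\<in>\<T>. x \<notin> frontier T"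
  shows "((\<lambda>h. u (x + h *\<^sub>R axis i 1) * \<psi> (x + h *\<^sub>R axis i 1) $ i) has_real_derivative
           pw_grad u x $ i * \<psi> x $ i + u x * (frechet_derivative \<psi> (at x) (axis i 1) $ i)) (at 0)"
proof -
  define D where "D = frechet_derivative \<psi> (at x)"
  have D: "(\<psi> has_derivative D) (at x)" unfolding D_def by (rule C1c_has_derivative[OF \<psi>])
  have "((\<lambda>y. u y * \<psi> y $ i) has_derivative
      (\<lambda>v. (pw_grad u x \<bullet> v) * \<psi> x $ i + u x * (D v $ i))) (at x)"
  proof (cases "\<exists>T\<in>\<T>. x \<in> T")
    case True
    then obtain T where T: "T \<in> \<T>" "x \<in> T" by blast
    obtain c where c: "\<And>y. y \<in> closure T \<Longrightarrow> y \<in> \<Omega> \<Longrightarrow> u y = grad u T \<bullet> y + c"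
      using P1_affine_on_closed_triangle[OF u T(1)] by blast
    have c': "u y = grad u T \<bullet> y + c" if "y \<in> T" for y
      using c that closure_subset[of T] triangle(2)[OF T(1)] by blast
    have "((\<lambda>y. (grad u T \<bullet> y + c) * \<psi> y $ i) has_derivative
      (\<lambda>v. (grad u T \<bullet> x + c) * (D v $ i) + (grad u T \<bullet> v) * \<psi> x $ i)) (at x)"
      by (auto intro!: derivative_eq_intros bounded_linear.has_derivative[OF bounded_linear_vec_nth] D)
    then have "((\<lambda>y. u y * \<psi> y $ i) has_derivative
      (\<lambda>v. (grad u T \<bullet> x + c) * (D v $ i) + (grad u T \<bullet> v) * \<psi> x $ i)) (at x)"
      by (rule has_derivative_transform_within_open[OF _ triangle(3)[OF T(1)] T(2)]) (simp add: c')
    then show ?thesis by (simp add: c'[OF T(2)] pw_grad_on_triangle[OF T] add.commute)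
  next
    case False
    have nc: "x \<notin> closure T" if "T \<in> \<T>" for T
      using that x False by (auto simp: frontier_def interior_open triangle(3))
    then have "x \<in> - closure \<Omega>" using triangles_cover by auto
    moreover have "open (- closure \<Omega>)" by (intro open_Compl closed_closure)
    moreover have u0: "u y = 0" if "y \<in> - closure \<Omega>" for y
      using that closure_subset[of \<Omega>] by (intro P1_zero_outside[OF u]) auto
    ultimately have "((\<lambda>y. u y * \<psi> y $ i) has_derivative (\<lambda>_. 0)) (at x)"
      by (intro has_derivative_transform_within_open[OF has_derivative_const[of 0]]) auto
    moreover have "u x = 0" using \<open>x \<in> - closure \<Omega>\<close> by (rule u0)
    moreover have "pw_grad u x = 0" using False by (intro pw_grad_outside) auto
    ultimately show ?thesis by simp
  qed
  then have "((\<lambda>y. u y * \<psi> y $ i) has_derivative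
      (\<lambda>v. (pw_grad u x \<bullet> v) * \<psi> x $ i + u x * (D v $ i))) (at (x + 0 *\<^sub>R axis i 1))" by simp
  moreover have "((\<lambda>h. x + h *\<^sub>R axis i (1::real)) has_derivative (\<lambda>h. h *\<^sub>R axis i 1)) (at 0)"
    by (auto intro!: derivative_eq_intros)
  ultimately have "((\<lambda>h. u (x + h *\<^sub>R axis i 1) * \<psi> (x + h *\<^sub>R axis i 1) $ i) has_derivative
      (\<lambda>h. (pw_grad u x \<bullet> (h *\<^sub>R axis i 1)) * \<psi> x $ i + u x * (D (h *\<^sub>R axis i 1) $ i))) (at 0)"
    by (rule has_derivative_compose[rotated])
  moreover have "linear D" using D has_derivative_linear by blast
  then have "(\<lambda>h. (pw_grad u x \<bullet> (h *\<^sub>R axis i 1)) * \<psi> x $ i + u x * (D (h *\<^sub>R axis i 1) $ i))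
      = (*) (pw_grad u x $ i * \<psi> x $ i + u x * (D (axis i 1) $ i))"
    by (simp add: fun_eq_iff linear_scale inner_axis algebra_simps)
  ultimately show ?thesis
    unfolding has_field_derivative_def D_def[symmetric] by simp
qed

text \<open>
  The product rule splits the \<open>i\<close>-th partial derivative of \<open>u * \<psi> $ i\<close> into \<open>P i\<close> and
  \<open>Q i\<close>. Its integral is zero, and the sum of the \<open>Q i\<close> is \<open>u\<close> times the divergence.
\<close>

lemma P1_integration_by_parts:
  assumes u: "u \<in> P1 \<Omega> \<T>" and \<psi>: "\<psi> \<in> C1c \<Omega>"
  shows "(LINT x:\<Omega>|lborel. u x * divergence \<psi> x)
       = - (\<Sum>T\<in>\<T>. LINT x|lborel. indicator T x * (grad u T \<bullet> \<psi> x))"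
proof -
  obtain K where K: "compact K" "K \<subseteq> \<Omega>" "\<And>x. x \<notin> K \<Longrightarrow> \<psi> x = 0"
    "\<And>x v. x \<notin> K \<Longrightarrow> frechet_derivative \<psi> (at x) v = 0"
    using C1c_support[OF \<psi>] by metis
  obtain M where M: "\<And>x. \<bar>u x\<bar> \<le> M" using P1_bounded[OF u] by blast
  define P where "P i x = pw_grad u x $ i * \<psi> x $ i" for i x
  define Q where "Q i x = u x * (frechet_derivative \<psi> (at x) (axis i 1) $ i)" for i x
  have intP: "integrable lborel (P i)" for i
  proof -
    obtain B where "\<And>x. \<bar>pw_grad u x $ i\<bar> \<le> B" using pw_grad_bounded by blast
    then show ?thesis unfolding P_def
      by (intro integrable_bounded_mult_compact_support[OF _ K(1) _ pw_grad_measurable])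
         (auto simp: K(3) intro!: continuous_intros C1c_continuous[OF \<psi>])
  qed
  have intQ: "integrable lborel (Q i)" for i
    unfolding Q_def
    by (intro integrable_bounded_mult_compact_support[OF _ K(1) _ P1_measurable[OF u] M])
       (auto simp: K(4) intro!: continuous_intros C1c_derivative_continuous[OF \<psi>])
  obtain R where R: "\<And>x. x \<in> K \<Longrightarrow> norm x < R"
    using compact_imp_bounded[OF K(1)] unfolding bounded_pos_less by blast
  have zero: "(LINT x|lborel. P i x + Q i x) = 0" for i
  proof -
    obtain L where L: "L-lipschitz_on UNIV (\<lambda>x. u x * \<psi> x $ i)"
      using P1_mult_C1c_lipschitz[OF u \<psi>] by blast
    show ?thesis
    proof (rule integral_directional_derivative_eq_0[OF L])
      show "u x * \<psi> x $ i = 0" if "R \<le> norm x" for x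
      proof -
        have "x \<notin> K" using R[of x] that by auto
        then show ?thesis by (simp add: K(3))
      qed
      show "(\<lambda>x. P i x + Q i x) \<in> borel_measurable borel"
        using borel_measurable_integrable[OF intP[of i]] borel_measurable_integrable[OF intQ[of i]]
        by simp
      show "AE x in lborel. ((\<lambda>h. u (x + h *\<^sub>R axis i 1) * \<psi> (x + h *\<^sub>R axis i 1) $ i)
          has_real_derivative P i x + Q i x) (at 0)"
        using AE_off_frontiers
        by eventually_elim (unfold P_def Q_def, rule P1_mult_C1c_derivative[OF u \<psi>])
    qed
  qed
  have "(LINT x|lborel. (\<Sum>i\<in>UNIV. Q i x)) = (\<Sum>i\<in>UNIV. LINT x|lborel. Q i x)"
    using intQ by (rule Bochner_Integration.integral_sum)
  also have "\<dots> = (\<Sum>i\<in>UNIV. - (LINT x|lborel. P i x))"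
  proof (rule sum.cong)
    fix i show "(LINT x|lborel. Q i x) = - (LINT x|lborel. P i x)"
      using zero[of i] Bochner_Integration.integral_add[OF intP[of i] intQ[of i]] by simp
  qed simp
  also have "\<dots> = - (LINT x|lborel. (\<Sum>i\<in>UNIV. P i x))"
    using intP by (simp add: sum_negf Bochner_Integration.integral_sum)
  also have "(LINT x|lborel. (\<Sum>i\<in>UNIV. P i x))
      = (LINT x|lborel. (\<Sum>T\<in>\<T>. indicator T x * (grad u T \<bullet> \<psi> x)))"
  proof (rule Bochner_Integration.integral_cong)
    fix x
    have "(\<Sum>i\<in>UNIV. P i x) = pw_grad u x \<bullet> \<psi> x" by (simp add: P_def inner_vec_def)
    also have "\<dots> = (\<Sum>T\<in>\<T>. indicator T x * (grad u T \<bullet> \<psi> x))"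
      by (simp add: pw_grad_def inner_sum_left)
    finally show "(\<Sum>i\<in>UNIV. P i x) = (\<Sum>T\<in>\<T>. indicator T x * (grad u T \<bullet> \<psi> x))" .
  qed simp
  also have "\<dots> = (\<Sum>T\<in>\<T>. LINT x|lborel. indicator T x * (grad u T \<bullet> \<psi> x))"
  proof (rule Bochner_Integration.integral_sum)
    fix T assume "T \<in> \<T>"
    then have "indicator T \<in> borel_measurable borel"
      by (intro borel_measurable_indicator borel_open triangle(3))
    then show "integrable lborel (\<lambda>x. indicator T x * (grad u T \<bullet> \<psi> x))"
      by (intro integrable_bounded_mult_compact_support[where M = 1 and K = K])
         (auto simp: K(3) intro!: continuous_intros C1c_continuous[OF \<psi>] K(1))
  qed
  finally have "(LINT x|lborel. (\<Sum>i\<in>UNIV. Q i x))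
      = - (\<Sum>T\<in>\<T>. LINT x|lborel. indicator T x * (grad u T \<bullet> \<psi> x))" .
  moreover have "(LINT x:\<Omega>|lborel. u x * divergence \<psi> x) = (LINT x|lborel. (\<Sum>i\<in>UNIV. Q i x))"
    unfolding set_lebesgue_integral_def
    by (rule Bochner_Integration.integral_cong)
       (auto simp: Q_def divergence_def sum_distrib_left indicator_def P1_zero_outside[OF u])
  ultimately show ?thesis by simp
qed

end

section \<open>Total variation as an energy\<close>

definition smooth_step :: "real \<Rightarrow> real" where
  "smooth_step r = (max 0 r)\<^sup>2 / (1 + (max 0 r)\<^sup>2)"

lemma smooth_step_bounds: "0 \<le> smooth_step r" "smooth_step r \<le> 1"
proof -
  have "1 + (max 0 r)\<^sup>2 > 0" by (simp add: add_pos_nonneg)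
  then show "0 \<le> smooth_step r" "smooth_step r \<le> 1" by (simp_all add: smooth_step_def)
qed

lemma smooth_step_eq_0: "r \<le> 0 \<Longrightarrow> smooth_step r = 0"
  by (simp add: smooth_step_def max_def)

text \<open>
  The square of the positive part is the simplest function that vanishes on a half line and is
  continuously differentiable; it is the building block of the cutoff functions.
\<close>

lemma max_0_power2_has_derivative:
  "((\<lambda>r::real. (max 0 r)\<^sup>2) has_real_derivative 2 * max 0 r) (at r)"
proof -
  consider "r > 0" | "r < 0" | "r = 0" by linarith
  then show ?thesis
  proof cases
    case 1
    have "((\<lambda>r::real. r\<^sup>2) has_real_derivative 2 * max 0 r) (at r)"
      using 1 by (auto intro!: derivative_eq_intros)
    then show ?thesis
      by (rule has_field_derivative_transform_within_open[where S = "{0<..}"]) (use 1 in auto)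
  next
    case 2
    have "((\<lambda>r::real. 0) has_real_derivative 2 * max 0 r) (at r)"
      using 2 by (auto intro!: derivative_eq_intros)
    then show ?thesis
      by (rule has_field_derivative_transform_within_open[where S = "{..<0}"]) (use 2 in auto)
  next
    case 3
    have "((\<lambda>h::real. (max 0 h)\<^sup>2 / h) \<longlongrightarrow> 0) (at 0)"
    proof (rule Lim_null_comparison)
      show "\<forall>\<^sub>F h in at (0::real). norm ((max 0 h)\<^sup>2 / h) \<le> \<bar>h\<bar>"
        by (intro always_eventually) (auto simp: max_def power2_eq_square)
      show "((\<lambda>h::real. \<bar>h\<bar>) \<longlongrightarrow> 0) (at 0)" by (auto intro!: tendsto_eq_intros)
    qed
    then show ?thesis using 3 by (simp add: DERIV_def)
  qed
qed

lemma smooth_step_has_derivative: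
  "(smooth_step has_real_derivative 2 * max 0 r / (1 + (max 0 r)\<^sup>2)\<^sup>2) (at r)"
proof -
  have pos: "1 + (max 0 r)\<^sup>2 \<noteq> 0"
    using add_pos_nonneg[of 1 "(max 0 r)\<^sup>2"] by simp
  show ?thesis unfolding smooth_step_def[abs_def]
    by (rule derivative_eq_intros max_0_power2_has_derivative refl pos)+
       (simp add: power2_eq_square algebra_simps)
qed

lemma smooth_step_tendsto_1: "(smooth_step \<longlongrightarrow> 1) at_top"
proof -
  have "((\<lambda>r::real. 1 - inverse (1 + r\<^sup>2)) \<longlongrightarrow> 1 - 0) at_top"
    by (intro tendsto_diff tendsto_const tendsto_inverse_0_at_top
          filterlim_tendsto_add_at_top[OF tendsto_const] filterlim_pow_at_top filterlim_ident) simp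
  moreover have "\<forall>\<^sub>F r in at_top. 1 - inverse (1 + r\<^sup>2) = smooth_step r"
    using eventually_gt_at_top[of "0::real"]
  proof eventually_elim
    fix r :: real assume "r > 0"
    moreover have "1 + r\<^sup>2 \<noteq> 0" using add_pos_nonneg[of 1 "r\<^sup>2"] by simp
    ultimately show "1 - inverse (1 + r\<^sup>2) = smooth_step r"
      by (simp add: smooth_step_def field_simps)
  qed
  ultimately show ?thesis by (simp add: tendsto_cong)
qed

lemma C1cI:
  assumes "\<And>x. (\<psi> has_derivative D x) (at x)" "\<And>v. continuous_on UNIV (\<lambda>x. D x v)"
    and "compact K" "K \<subseteq> \<Omega>" "\<And>x. x \<notin> K \<Longrightarrow> \<psi> x = 0"
  shows "\<psi> \<in> C1c \<Omega>"
proof -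
  have "frechet_derivative \<psi> (at x) = D x" for x using frechet_derivative_at[OF assms(1)] by metis
  then show ?thesis using assms unfolding C1c_def differentiable_def by auto
qed

lemma C1c_add:
  assumes "\<phi> \<in> C1c \<Omega>" "\<psi> \<in> C1c \<Omega>"
  shows "(\<lambda>x. \<phi> x + \<psi> x) \<in> C1c \<Omega>"
proof -
  obtain K where K: "compact K" "K \<subseteq> \<Omega>" "\<And>x. x \<notin> K \<Longrightarrow> \<phi> x = 0"
    using C1c_support[OF assms(1)] by metis
  obtain K' where K': "compact K'" "K' \<subseteq> \<Omega>" "\<And>x. x \<notin> K' \<Longrightarrow> \<psi> x = 0"
    using C1c_support[OF assms(2)] by metis
  show ?thesis
    by (rule C1cI[where K = "K \<union> K'" and
          D = "\<lambda>x v. frechet_derivative \<phi> (at x) v + frechet_derivative \<psi> (at x) v"])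
       (use K K' assms in \<open>auto intro!: derivative_eq_intros C1c_has_derivative continuous_intros
          C1c_derivative_continuous\<close>)
qed

lemma C1c_sum:
  assumes "finite I" "\<And>i. i \<in> I \<Longrightarrow> f i \<in> C1c \<Omega>"
  shows "(\<lambda>x. \<Sum>i\<in>I. f i x) \<in> C1c \<Omega>"
  using assms
proof (induction I)
  case empty
  show ?case by (rule C1cI[where K = "{}" and D = "\<lambda>_ _. 0"]) (auto intro!: derivative_eq_intros)
next
  case (insert i I)
  then show ?case by (simp add: C1c_add)
qed

lemma C1c_mono: "\<psi> \<in> C1c A \<Longrightarrow> A \<subseteq> B \<Longrightarrow> \<psi> \<in> C1c B"
  unfolding C1c_def by blast

text \<open>
  The product of \<open>smooth_step (n * \<beta> - 1)\<close> over the three barycentric coordinates \<open>\<beta>\<close> vanishes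
  unless all of them are at least \<open>1 / n\<close>. This describes a compact subset of the open triangle,
  and the product tends to \<open>1\<close> as \<open>n\<close> grows.
\<close>

lemma open_triangle_cutoff:
  assumes "open_triangle T"
  shows "\<exists>\<eta> :: nat \<Rightarrow> real^2 \<Rightarrow> real. (\<forall>n v. (\<lambda>x. \<eta> n x *\<^sub>R v) \<in> C1c T) \<and>
    (\<forall>n. continuous_on UNIV (\<eta> n)) \<and> (\<forall>n x. 0 \<le> \<eta> n x \<and> \<eta> n x \<le> 1 \<and> (x \<notin> T \<longrightarrow> \<eta> n x = 0)) \<and>
    (\<forall>x\<in>T. (\<lambda>n. \<eta> n x) \<longlonglongrightarrow> 1)"
proof -
  obtain g1 k1 g2 k2 g3 k3 where
    T: "T = {x. 0 < g1 \<bullet> x + k1 \<and> 0 < g2 \<bullet> x + k2 \<and> 0 < g3 \<bullet> x + k3}"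
    using open_triangle_barycentric[OF assms] by blast
  define \<sigma> where "\<sigma> g k n x = smooth_step (real n * (g \<bullet> x + k) - 1)" for g k n and x :: "real^2"
  define \<sigma>' where "\<sigma>' g k n x v = real n * (g \<bullet> v) * (2 * max 0 (real n * (g \<bullet> x + k) - 1) /
      (1 + (max 0 (real n * (g \<bullet> x + k) - 1))\<^sup>2)\<^sup>2)" for g k n and x v :: "real^2"
  have \<sigma>: "(\<sigma> g k n has_derivative \<sigma>' g k n x) (at x)" for g k n x
    unfolding \<sigma>_def[abs_def] \<sigma>'_def[abs_def]
    by (rule DERIV_compose_FDERIV[OF smooth_step_has_derivative]) (auto intro!: derivative_eq_intros)
  have \<sigma>'_cont: "continuous_on UNIV (\<lambda>x. \<sigma>' g k n x v)" for g k n v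
  proof -
    have "1 + (max 0 (real n * (g \<bullet> x + k) - 1))\<^sup>2 \<noteq> 0" for x
      using add_pos_nonneg[of 1 "(max 0 (real n * (g \<bullet> x + k) - 1))\<^sup>2"] by simp
    then show ?thesis unfolding \<sigma>'_def by (intro continuous_intros) auto
  qed
  have \<sigma>_cont: "continuous_on UNIV (\<sigma> g k n)" for g k n
    using \<sigma> by (intro continuous_at_imp_continuous_on ballI has_derivative_continuous)
  have \<sigma>_lim: "(\<lambda>n. \<sigma> g k n x) \<longlonglongrightarrow> 1" if "0 < g \<bullet> x + k" for g k x
    unfolding \<sigma>_def
  proof (rule filterlim_compose[OF smooth_step_tendsto_1])
    have "filterlim (\<lambda>n. -1 + real n * (g \<bullet> x + k)) at_top sequentially"
      by (intro filterlim_tendsto_add_at_top[OF tendsto_const]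
            filterlim_at_top_mult_tendsto_pos[OF tendsto_const that] filterlim_real_sequentially)
    then show "filterlim (\<lambda>n. real n * (g \<bullet> x + k) - 1) at_top sequentially"
      by (simp add: algebra_simps)
  qed
  have \<sigma>_bd: "0 \<le> \<sigma> g k n x" "\<sigma> g k n x \<le> 1" for g k n x
    unfolding \<sigma>_def by (rule smooth_step_bounds)+
  define \<eta> where "\<eta> n x = \<sigma> g1 k1 n x * (\<sigma> g2 k2 n x * \<sigma> g3 k3 n x)" for n x
  define K where "K n = {x. 0 \<le> real n * (g1 \<bullet> x + k1) - 1} \<inter>
     ({x. 0 \<le> real n * (g2 \<bullet> x + k2) - 1} \<inter> {x. 0 \<le> real n * (g3 \<bullet> x + k3) - 1})" for n
  have K_sub: "K n \<subseteq> T" for n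
  proof -
    have "0 < r" if "0 \<le> real n * r - 1" for r
      using that by (simp add: zero_less_mult_iff order.strict_implies_order)
        (smt (verit) mult_nonneg_nonpos of_nat_0_le_iff)
    then show ?thesis unfolding K_def T by auto
  qed
  have K: "compact (K n)" for n
  proof -
    have "closed (K n)" unfolding K_def
      by (intro closed_Int closed_Collect_le continuous_intros)
    moreover have "bounded (K n)" using bounded_subset[OF open_triangle_basic(3)[OF assms] K_sub] .
    ultimately show ?thesis by (simp add: compact_eq_bounded_closed)
  qed
  have \<eta>_0: "\<eta> n x = 0" if "x \<notin> K n" for n x
    using that smooth_step_eq_0 unfolding K_def \<eta>_def \<sigma>_def by force
  have "(\<lambda>x. \<eta> n x *\<^sub>R v) \<in> C1c T" for n v
  proof (rule C1cI[OF _ _ K[of n] K_sub[of n]])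
    fix x
    show "((\<lambda>x. \<eta> n x *\<^sub>R v) has_derivative (\<lambda>w. (\<sigma> g1 k1 n x *
        (\<sigma> g2 k2 n x * \<sigma>' g3 k3 n x w + \<sigma>' g2 k2 n x w * \<sigma> g3 k3 n x)
        + \<sigma>' g1 k1 n x w * (\<sigma> g2 k2 n x * \<sigma> g3 k3 n x)) *\<^sub>R v)) (at x)"
      unfolding \<eta>_def by (intro has_derivative_scaleR_left has_derivative_mult \<sigma>)
  next
    fix w
    show "continuous_on UNIV (\<lambda>x. (\<sigma> g1 k1 n x *
        (\<sigma> g2 k2 n x * \<sigma>' g3 k3 n x w + \<sigma>' g2 k2 n x w * \<sigma> g3 k3 n x)
        + \<sigma>' g1 k1 n x w * (\<sigma> g2 k2 n x * \<sigma> g3 k3 n x)) *\<^sub>R v)"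
      by (intro continuous_intros \<sigma>_cont \<sigma>'_cont)
  qed (simp add: \<eta>_0)
  moreover have "continuous_on UNIV (\<eta> n)" for n
    unfolding \<eta>_def[abs_def] by (intro continuous_intros \<sigma>_cont)
  moreover have "0 \<le> \<eta> n x \<and> \<eta> n x \<le> 1 \<and> (x \<notin> T \<longrightarrow> \<eta> n x = 0)" for n x
  proof (intro conjI impI)
    show "0 \<le> \<eta> n x" unfolding \<eta>_def by (intro mult_nonneg_nonneg \<sigma>_bd)
    show "\<eta> n x \<le> 1" unfolding \<eta>_def by (intro mult_le_one mult_nonneg_nonneg \<sigma>_bd)
    show "\<eta> n x = 0" if "x \<notin> T" using that K_sub[of n] by (intro \<eta>_0) auto
  qed
  moreover have "(\<lambda>n. \<eta> n x) \<longlonglongrightarrow> 1" if "x \<in> T" for x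
  proof -
    have "(\<lambda>n. \<eta> n x) \<longlonglongrightarrow> 1 * (1 * 1)"
      unfolding \<eta>_def by (intro tendsto_mult \<sigma>_lim) (use that T in auto)
    then show ?thesis by simp
  qed
  ultimately show ?thesis by blast
qed

context triangulated_domain
begin

lemma TV_le_energy:
  assumes u: "u \<in> P1 \<Omega> \<T>"
  shows "TV u \<Omega> \<le> ereal (energy u)"
  unfolding TV_def
proof (rule SUP_least)
  fix \<psi> assume "\<psi> \<in> {\<psi> \<in> C1c \<Omega>. \<forall>x. norm (\<psi> x) \<le> 1}"
  then have \<psi>: "\<psi> \<in> C1c \<Omega>" and \<psi>1: "\<And>x. norm (\<psi> x) \<le> 1" by auto
  have "- (LINT x|lborel. indicator T x * (grad u T \<bullet> \<psi> x)) \<le> measure lborel T * norm (grad u T)"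
    if T: "T \<in> \<T>" for T
  proof -
    have [measurable]: "T \<in> sets borel" using triangle(3)[OF T] by simp
    have "norm (LINT x|lborel. indicator T x * (grad u T \<bullet> \<psi> x))
       \<le> (LINT x|lborel. norm (indicator T x * (grad u T \<bullet> \<psi> x)))"
      by (rule integral_norm_bound)
    also have "\<dots> \<le> (LINT x|lborel. indicator T x * norm (grad u T))"
    proof (rule integral_mono')
      show "integrable lborel (\<lambda>x. indicator T x * norm (grad u T))"
        using emeasure_bounded_finite[OF triangle(6)[OF T]]
        by (intro integrable_mult_left integrable_real_indicator) auto
      fix x
      have "\<bar>grad u T \<bullet> \<psi> x\<bar> \<le> norm (grad u T) * norm (\<psi> x)" by (rule Cauchy_Schwarz_ineq2)
      also have "\<dots> \<le> norm (grad u T)" using \<psi>1[of x] by (simp add: mult_left_le)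
      finally show "norm (indicator T x * (grad u T \<bullet> \<psi> x)) \<le> indicator T x * norm (grad u T)"
        by (simp add: abs_mult indicator_def)
    qed simp
    also have "\<dots> = measure lborel T * norm (grad u T)" by simp
    finally show ?thesis by simp
  qed
  then have "(\<Sum>T\<in>\<T>. - (LINT x|lborel. indicator T x * (grad u T \<bullet> \<psi> x))) \<le> energy u"
    unfolding energy_def by (rule sum_mono)
  then show "ereal (LINT x:\<Omega>|lborel. u x * divergence \<psi> x) \<le> ereal (energy u)"
    by (simp add: P1_integration_by_parts[OF u \<psi>] sum_negf)
qed

text \<open>
  The integral of \<open>u\<close> times the divergence would be the energy if the test field were
  \<open>- sgn (grad u T)\<close> on each \<open>T\<close>. Cutoffs turn this discontinuous field into test fields that
  converge to it on every triangle.
\<close>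

lemma energy_le_TV:
  assumes u: "u \<in> P1 \<Omega> \<T>"
  shows "ereal (energy u) \<le> TV u \<Omega>"
proof -
  have "\<forall>T\<in>\<T>. \<exists>\<eta> :: nat \<Rightarrow> real^2 \<Rightarrow> real. (\<forall>n v. (\<lambda>x. \<eta> n x *\<^sub>R v) \<in> C1c T) \<and>
    (\<forall>n. continuous_on UNIV (\<eta> n)) \<and> (\<forall>n x. 0 \<le> \<eta> n x \<and> \<eta> n x \<le> 1 \<and> (x \<notin> T \<longrightarrow> \<eta> n x = 0)) \<and>
    (\<forall>x\<in>T. (\<lambda>n. \<eta> n x) \<longlonglongrightarrow> 1)"
    using open_triangle_cutoff triangle(1) by blast
  from bchoice[OF this] obtain \<eta> :: "(real^2) set \<Rightarrow> nat \<Rightarrow> real^2 \<Rightarrow> real" where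
    \<eta>: "\<forall>T\<in>\<T>. (\<forall>n v. (\<lambda>x. \<eta> T n x *\<^sub>R v) \<in> C1c T) \<and>
    (\<forall>n. continuous_on UNIV (\<eta> T n)) \<and> (\<forall>n x. 0 \<le> \<eta> T n x \<and> \<eta> T n x \<le> 1 \<and> (x \<notin> T \<longrightarrow> \<eta> T n x = 0)) \<and>
    (\<forall>x\<in>T. (\<lambda>n. \<eta> T n x) \<longlonglongrightarrow> 1)" by blast
  have \<eta>_C1c: "(\<lambda>x. \<eta> T n x *\<^sub>R v) \<in> C1c \<Omega>" if "T \<in> \<T>" for T n v
    using \<eta> that C1c_mono[OF _ triangle(2)[OF that]] by blast
  have \<eta>_cont: "continuous_on UNIV (\<eta> T n)" if "T \<in> \<T>" for T n using \<eta> that by blast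
  have \<eta>_bd: "0 \<le> \<eta> T n x" "\<eta> T n x \<le> 1" if "T \<in> \<T>" for T n x using \<eta> that by blast+
  have \<eta>_0: "\<eta> T n x = 0" if "T \<in> \<T>" "x \<notin> T" for T n x using \<eta> that by blast
  have \<eta>_lim: "(\<lambda>n. \<eta> T n x) \<longlonglongrightarrow> 1" if "T \<in> \<T>" "x \<in> T" for T x using \<eta> that by blast
  define \<psi> where "\<psi> n x = (\<Sum>T\<in>\<T>. \<eta> T n x *\<^sub>R - sgn (grad u T))" for n x
  have \<psi>_on: "\<psi> n x = \<eta> T n x *\<^sub>R - sgn (grad u T)" if T: "T \<in> \<T>" "x \<in> T" for n T x
  proof -
    have "\<psi> n x = (\<Sum>T\<in>\<T>. indicator T x *\<^sub>R (\<eta> T n x *\<^sub>R - sgn (grad u T)))"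
      unfolding \<psi>_def
    proof (rule sum.cong)
      fix T assume "T \<in> \<T>"
      then show "\<eta> T n x *\<^sub>R - sgn (grad u T) = indicator T x *\<^sub>R (\<eta> T n x *\<^sub>R - sgn (grad u T))"
        by (cases "x \<in> T") (simp_all add: \<eta>_0)
    qed simp
    then show ?thesis by (simp only: sum_indicator_triangles[OF T])
  qed
  have \<psi>_C1c: "\<psi> n \<in> C1c \<Omega>" for n
    unfolding \<psi>_def[abs_def] by (intro C1c_sum finite_triangles \<eta>_C1c)
  have \<psi>_1: "norm (\<psi> n x) \<le> 1" for n x
  proof (cases "\<exists>T\<in>\<T>. x \<in> T")
    case True
    then obtain T where T: "T \<in> \<T>" "x \<in> T" by blast
    have "norm (\<psi> n x) = \<eta> T n x * norm (sgn (grad u T))" using \<eta>_bd(1)[OF T(1)] by (simp add: \<psi>_on[OF T])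
    also have "\<dots> \<le> 1" using \<eta>_bd[OF T(1)] by (intro mult_le_one) (auto simp: norm_sgn)
    finally show ?thesis .
  next
    case False
    then have "\<psi> n x = 0" unfolding \<psi>_def by (intro sum.neutral ballI) (simp add: \<eta>_0)
    then show ?thesis by simp
  qed
  define m where "m T n = (LINT x|lborel. indicator T x * \<eta> T n x)" for T n
  have m_lim: "m T \<longlonglongrightarrow> measure lborel T" if T: "T \<in> \<T>" for T
  proof -
    have [measurable]: "T \<in> sets borel" using triangle(3)[OF T] by simp
    have [measurable]: "\<eta> T n \<in> borel_measurable borel" for n
      using \<eta>_cont[OF T] by (rule borel_measurable_continuous_onI)
    have int: "integrable lborel (indicator T :: real^2 \<Rightarrow> real)"
      using emeasure_bounded_finite[OF triangle(6)[OF T]] by (intro integrable_real_indicator) auto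
    have "m T \<longlonglongrightarrow> (LINT x|lborel. indicator T x)"
      unfolding m_def
    proof (rule integral_dominated_convergence[where w = "indicator T"])
      show "AE x in lborel. (\<lambda>n. indicator T x * \<eta> T n x) \<longlonglongrightarrow> (indicator T x :: real)"
        using \<eta>_lim[OF T] by (intro AE_I2) (auto simp: indicator_def)
      show "AE x in lborel. norm (indicator T x * \<eta> T n x) \<le> indicator T x" for n
        using \<eta>_bd[OF T] by (intro AE_I2) (auto simp: indicator_def)
    qed (use int in auto)
    then show ?thesis by simp
  qed
  have val: "(LINT x:\<Omega>|lborel. u x * divergence (\<psi> n) x) = (\<Sum>T\<in>\<T>. m T n * norm (grad u T))" for n
  proof -
    have "(LINT x|lborel. indicator T x * (grad u T \<bullet> \<psi> n x)) = - (m T n * norm (grad u T))"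
      if T: "T \<in> \<T>" for T
    proof -
      have sg: "grad u T \<bullet> sgn (grad u T) = norm (grad u T)"
        by (simp add: sgn_div_norm power2_norm_eq_inner[symmetric] power2_eq_square field_simps)
      have "(LINT x|lborel. indicator T x * (grad u T \<bullet> \<psi> n x))
          = (LINT x|lborel. - norm (grad u T) * (indicator T x * \<eta> T n x))"
        by (intro Bochner_Integration.integral_cong) (auto simp: indicator_def \<psi>_on[OF T] sg)
      also have "\<dots> = - norm (grad u T) * m T n"
        unfolding m_def by (rule Bochner_Integration.integral_mult_right_zero)
      finally show ?thesis by simp
    qed
    then show ?thesis by (simp add: P1_integration_by_parts[OF u \<psi>_C1c] sum_negf)
  qed
  have lim: "(\<lambda>n. ereal (\<Sum>T\<in>\<T>. m T n * norm (grad u T))) \<longlonglongrightarrow> ereal (energy u)"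
    unfolding energy_def by (intro tendsto_intros m_lim)
  have le: "ereal (\<Sum>T\<in>\<T>. m T n * norm (grad u T)) \<le> TV u \<Omega>" for n
    unfolding TV_def val[symmetric] by (rule SUP_upper) (simp add: \<psi>_C1c \<psi>_1)
  show ?thesis by (rule LIMSEQ_le_const2[OF lim]) (use le in blast)
qed

end

section \<open>Rigidity and extremal points\<close>

text \<open>
  Equality in the triangle inequality forces parallel vectors. Stated as a multiple of the sum, this
  includes the case where the sum is zero.
\<close>

lemma parallel_if_norm_add_eq:
  fixes x y :: "'a::real_inner"
  assumes "norm (x + y) = norm x + norm y"
  shows "\<exists>l. x = l *\<^sub>R (x + y)"
proof (cases "x + y = 0")
  case True
  then have "norm x + norm y = 0" using assms by simp
  then have "norm x = 0" using norm_ge_zero[of x] norm_ge_zero[of y] by linarith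
  then show ?thesis by (intro exI[of _ 0]) simp
next
  case False
  have "norm x *\<^sub>R y = norm y *\<^sub>R x" using assms by (simp add: norm_triangle_eq)
  then have "norm (x + y) *\<^sub>R x = norm x *\<^sub>R (x + y)"
    by (simp add: assms scaleR_left_distrib scaleR_right_distrib)
  then have "inverse (norm (x + y)) *\<^sub>R norm (x + y) *\<^sub>R x = inverse (norm (x + y)) *\<^sub>R norm x *\<^sub>R (x + y)"
    by (rule arg_cong)
  then have "x = (inverse (norm (x + y)) * norm x) *\<^sub>R (x + y)" using False by simp
  then show ?thesis ..
qed

lemma measure_lborel_open_pos:
  fixes S :: "'a::euclidean_space set"
  assumes "open S" "S \<noteq> {}" "bounded S"
  shows "measure lborel S > 0"
proof (rule ccontr)
  assume "\<not> measure lborel S > 0"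
  then have "measure lborel S = 0" using measure_nonneg[of lborel S] by linarith
  moreover have "emeasure lborel S \<noteq> \<infinity>" using emeasure_bounded_finite[OF assms(3)] by auto
  ultimately have "emeasure lborel S = 0" by (simp add: emeasure_eq_ennreal_measure)
  then have "S \<in> null_sets lborel" using assms(1) by (simp add: null_sets_def)
  then have "negligible S" by (simp add: negligible_iff_null_sets null_sets_completionI)
  with open_not_negligible assms show False by blast
qed

lemma open_triangle_closure_hull:
  assumes "open_triangle T"
  shows "closure T = convex hull (vertices T)"
  using open_triangleE[OF assms] by metis

lemma linear_functional_eq_0_if_const_on_vertices:
  assumes T: "open_triangle T" and d: "\<And>v. v \<in> vertices T \<Longrightarrow> g \<bullet> v = d"
  shows "g = 0"
proof -
  have "convex {x. g \<bullet> x = d}" by (rule convex_hyperplane)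
  then have "convex hull (vertices T) \<subseteq> {x. g \<bullet> x = d}"
    using d by (intro hull_minimal) auto
  then have "g \<bullet> x + 0 = 0 \<bullet> x + d" if "x \<in> T" for x
    using that closure_subset[of T] by (auto simp: open_triangle_closure_hull[OF T])
  from affine_function_eq_on_open(1)[OF open_triangle_basic(1,4)[OF T] this] show ?thesis by simp
qed

text \<open>
  For a point written as a convex combination of the vertices, the gap \<open>g \<bullet> z - g \<bullet> x\<close> is a
  nonnegative combination of positive gaps, and it vanishes only if all the weight is at \<open>z\<close>.
\<close>

lemma strict_max_on_triangle:
  assumes T: "open_triangle T" and z: "z \<in> vertices T"
    and less: "\<And>v. v \<in> vertices T \<Longrightarrow> v \<noteq> z \<Longrightarrow> g \<bullet> v < g \<bullet> z"
    and x: "x \<in> closure T" "x \<noteq> z"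
  shows "g \<bullet> x < g \<bullet> z"
proof -
  have main: "g \<bullet> x < g \<bullet> a" if "x \<in> convex hull {a,b,c}" "g \<bullet> b < g \<bullet> a" "g \<bullet> c < g \<bullet> a" "x \<noteq> a" for a b c
  proof -
    note hull = that(1)[unfolded convex_hull_3]
    obtain u v w where x: "x = u *\<^sub>R a + v *\<^sub>R b + w *\<^sub>R c" and uvw: "0 \<le> u" "0 \<le> v" "0 \<le> w" "u + v + w = 1"
      using hull by blast
    have u: "u = 1 - v - w" using uvw by simp
    have "v > 0 \<or> w > 0"
    proof (rule ccontr)
      assume "\<not> (v > 0 \<or> w > 0)"
      then have "v = 0" "w = 0" using uvw by auto
      with x u that(4) show False by simp
    qed
    then have "v * (g \<bullet> a - g \<bullet> b) > 0 \<or> w * (g \<bullet> a - g \<bullet> c) > 0"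
      using that(2,3) by (auto simp: zero_less_mult_iff)
    moreover have "v * (g \<bullet> a - g \<bullet> b) \<ge> 0" "w * (g \<bullet> a - g \<bullet> c) \<ge> 0" using uvw that(2,3) by auto
    ultimately have "v * (g \<bullet> a - g \<bullet> b) + w * (g \<bullet> a - g \<bullet> c) > 0" by linarith
    moreover have "g \<bullet> a - g \<bullet> x = v * (g \<bullet> a - g \<bullet> b) + w * (g \<bullet> a - g \<bullet> c)"
      by (simp add: x u algebra_simps)
    ultimately show ?thesis by simp
  qed
  obtain a b c where abc: "vertices T = {a,b,c}" "closure T = convex hull {a,b,c}" "a \<noteq> b" "b \<noteq> c" "a \<noteq> c"
    using T by (rule open_triangleE)
  have hull: "x \<in> convex hull {a,b,c}" "x \<in> convex hull {b,a,c}" "x \<in> convex hull {c,a,b}"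
    using x(1) abc(2) by (simp_all add: insert_commute)
  consider "z = a" | "z = b" | "z = c" using z abc(1) by auto
  then show ?thesis
  proof cases
    case 1 then show ?thesis using main[OF hull(1)] less abc x(2) by simp
  next
    case 2 then show ?thesis using main[OF hull(2)] less abc x(2) by simp
  next
    case 3 then show ?thesis using main[OF hull(3)] less abc x(2) by simp
  qed
qed

context triangulated_domain
begin

lemma TV_eq_energy: "u \<in> P1 \<Omega> \<T> \<Longrightarrow> TV u \<Omega> = ereal (energy u)"
  by (intro antisym TV_le_energy energy_le_TV)

lemma energy_scaled:
  assumes "\<And>T. T \<in> \<T> \<Longrightarrow> grad v T = l *\<^sub>R grad u T"
  shows "energy v = \<bar>l\<bar> * energy u"
  unfolding energy_def using assms by (simp add: sum_distrib_left mult.left_commute)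

text \<open>
  The difference has zero gradient, so it is constant on \<open>\<Omega>\<close>, and its mean is zero.
\<close>

lemma P1_mean_zero_eqI:
  assumes u: "u \<in> P1_mean_zero \<Omega> \<T>" and v: "v \<in> P1_mean_zero \<Omega> \<T>"
    and g: "\<And>T. T \<in> \<T> \<Longrightarrow> grad v T = l *\<^sub>R grad u T" and ne: "\<Omega> \<noteq> {}"
  shows "v = (\<lambda>x. l * u x)"
proof -
  have P: "u \<in> P1 \<Omega> \<T>" "v \<in> P1 \<Omega> \<T>" and m: "(LINT x|lborel. u x) = 0" "(LINT x|lborel. v x) = 0"
    using u v P1_set_integral by (auto simp: P1_mean_zero_def)
  define w where "w x = 1 * v x + (- l) * u x" for x
  have w: "w \<in> P1 \<Omega> \<T>" unfolding w_def[abs_def] by (rule P1_linear_combination(1)[OF P(2,1)])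
  have "grad w T = 0" if "T \<in> \<T>" for T
    unfolding w_def[abs_def] P1_linear_combination(2)[OF P(2,1) that] by (simp add: g[OF that])
  then obtain c where c: "\<And>x. x \<in> \<Omega> \<Longrightarrow> w x = c" using P1_eq_const_if_grad_zero[OF w] by blast
  have "(LINT x|lborel. w x) = 0"
    unfolding w_def using P1_integrable[OF P(1)] P1_integrable[OF P(2)] m by simp
  moreover have "(LINT x|lborel. w x) = (LINT x|lborel. indicator \<Omega> x * c)"
    using c P1_zero_outside[OF w] by (intro Bochner_Integration.integral_cong) (auto simp: indicator_def)
  ultimately have "measure lborel \<Omega> * c = 0" by simp
  then have "c = 0" using measure_lborel_open_pos[OF open_domain ne bounded_domain] by simp
  then have "w x = 0" for x using c P1_zero_outside[OF w] by (cases "x \<in> \<Omega>") auto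
  then show ?thesis by (auto simp: w_def fun_eq_iff)
qed

text \<open>
  Think of \<open>v\<close> as \<open>u\<close> with its gradients rescaled triangle by triangle. Rigidity says that continuity
  across the edges leaves no freedom but a common factor.
\<close>

definition rigid :: "(real^2 \<Rightarrow> real) \<Rightarrow> bool" where
  "rigid u \<longleftrightarrow> (\<forall>v\<in>P1 \<Omega> \<T>. (\<forall>T\<in>\<T>. \<exists>l. grad v T = l *\<^sub>R grad u T) \<longrightarrow>
     (\<exists>l. \<forall>T\<in>\<T>. grad v T = l *\<^sub>R grad u T))"

text \<open>
  In a convex combination of members of the ball that has energy one, the triangle inequality for
  gradients, summed over the triangles with their areas as weights, is an equality. So it is an
  equality on every triangle and the gradients of \<open>u1\<close> and \<open>u2\<close> are multiples of those of \<open>u\<close>. Rigidity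
  leaves \<open>u1 = l1 * u\<close> and \<open>u2 = l2 * u\<close>, where the factors are at most one and average to one.
\<close>

lemma rigid_imp_extremal:
  assumes u: "u \<in> P1_mean_zero \<Omega> \<T>" and E: "energy u = 1" and rigid: "rigid u"
  shows "extremal_in u (TV_ball \<Omega> \<T>)"
  unfolding extremal_in_def
proof (intro conjI notI; (elim exE conjE)?)
  have uP: "u \<in> P1 \<Omega> \<T>" using u by (simp add: P1_mean_zero_def)
  show "u \<in> TV_ball \<Omega> \<T>" using u E by (simp add: TV_ball_def TV_eq_energy[OF uP])
  fix s u1 u2
  assume s: "0 < s" "s < 1" and u12: "u1 \<in> TV_ball \<Omega> \<T>" "u2 \<in> TV_ball \<Omega> \<T>" "u1 \<noteq> u2"
    and comb: "u = (\<lambda>x. (1 - s) * u1 x + s * u2 x)"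
  have P: "u1 \<in> P1 \<Omega> \<T>" "u2 \<in> P1 \<Omega> \<T>" and Z: "u1 \<in> P1_mean_zero \<Omega> \<T>" "u2 \<in> P1_mean_zero \<Omega> \<T>"
    using u12 by (auto simp: TV_ball_def P1_mean_zero_def)
  have E12: "energy u1 \<le> 1" "energy u2 \<le> 1"
    using u12 TV_eq_energy[OF P(1)] TV_eq_energy[OF P(2)] by (auto simp: TV_ball_def)
  have g: "grad u T = (1 - s) *\<^sub>R grad u1 T + s *\<^sub>R grad u2 T" if "T \<in> \<T>" for T
    unfolding comb by (rule P1_linear_combination(2)[OF P that])
  let ?f = "\<lambda>T. measure lborel T * norm (grad u T)"
  let ?h = "\<lambda>T. measure lborel T * (norm ((1 - s) *\<^sub>R grad u1 T) + norm (s *\<^sub>R grad u2 T))"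
  have le: "?f T \<le> ?h T" if "T \<in> \<T>" for T
    unfolding g[OF that] by (intro mult_left_mono norm_triangle_ineq) simp
  have "sum ?h \<T> = (1 - s) * energy u1 + s * energy u2"
  proof -
    have "?h T = (1 - s) * (measure lborel T * norm (grad u1 T)) + s * (measure lborel T * norm (grad u2 T))" for T
    proof -
      have "norm ((1 - s) *\<^sub>R grad u1 T) = (1 - s) * norm (grad u1 T)" "norm (s *\<^sub>R grad u2 T) = s * norm (grad u2 T)"
        using s by simp_all
      then show ?thesis by (simp only: distrib_left mult.left_commute)
    qed
    then show ?thesis by (simp only: energy_def sum_distrib_left sum.distrib)
  qed
  also have "\<dots> \<le> (1 - s) * 1 + s * 1" using E12 s by (intro add_mono mult_left_mono) auto
  finally have "sum ?h \<T> \<le> sum ?f \<T>" using E by (simp add: energy_def)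
  moreover have "sum ?f \<T> \<le> sum ?h \<T>" using le by (rule sum_mono)
  ultimately have "sum ?f \<T> = sum ?h \<T>" by linarith
  then have fh: "?f T = ?h T" if "T \<in> \<T>" for T
    using sum_mono_inv[of ?f \<T> ?h T] le finite_triangles that by blast
  have eq: "norm ((1 - s) *\<^sub>R grad u1 T + s *\<^sub>R grad u2 T)
      = norm ((1 - s) *\<^sub>R grad u1 T) + norm (s *\<^sub>R grad u2 T)" if "T \<in> \<T>" for T
    using fh[OF that] measure_lborel_open_pos[OF triangle(3,4,6)[OF that]]
    unfolding g[OF that] mult_cancel_left by linarith
  have "\<exists>l. grad u1 T = l *\<^sub>R grad u T" if T: "T \<in> \<T>" for T
  proof -
    obtain l where "(1 - s) *\<^sub>R grad u1 T = l *\<^sub>R grad u T"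
      using parallel_if_norm_add_eq[OF eq[OF T]] g[OF T] by auto
    then have "inverse (1 - s) *\<^sub>R (1 - s) *\<^sub>R grad u1 T = inverse (1 - s) *\<^sub>R l *\<^sub>R grad u T" by simp
    then have "grad u1 T = (inverse (1 - s) * l) *\<^sub>R grad u T" using s by simp
    then show ?thesis ..
  qed
  then obtain l1 where l1: "\<And>T. T \<in> \<T> \<Longrightarrow> grad u1 T = l1 *\<^sub>R grad u T"
    using rigid P(1) unfolding rigid_def by blast
  have "\<exists>l. grad u2 T = l *\<^sub>R grad u T" if T: "T \<in> \<T>" for T
  proof -
    have "norm (s *\<^sub>R grad u2 T + (1 - s) *\<^sub>R grad u1 T)
      = norm (s *\<^sub>R grad u2 T) + norm ((1 - s) *\<^sub>R grad u1 T)"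
      using eq[OF T] by (simp only: add.commute)
    then obtain l where "s *\<^sub>R grad u2 T = l *\<^sub>R grad u T"
      using parallel_if_norm_add_eq g[OF T] by (metis add.commute)
    then have "inverse s *\<^sub>R s *\<^sub>R grad u2 T = inverse s *\<^sub>R l *\<^sub>R grad u T" by simp
    then have "grad u2 T = (inverse s * l) *\<^sub>R grad u T" using s by simp
    then show ?thesis ..
  qed
  then obtain l2 where l2: "\<And>T. T \<in> \<T> \<Longrightarrow> grad u2 T = l2 *\<^sub>R grad u T"
    using rigid P(2) unfolding rigid_def by blast
  obtain T where T: "T \<in> \<T>" "grad u T \<noteq> 0"
  proof (rule ccontr)
    assume "\<not> thesis"
    then have "energy u = 0" using that by (force simp: energy_def intro!: sum.neutral)
    with E show False by simp
  qed
  have "grad u T = ((1 - s) * l1 + s * l2) *\<^sub>R grad u T"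
    using g[OF T(1)] l1[OF T(1)] l2[OF T(1)] by (simp add: scaleR_left_distrib)
  then have "(1 - s) * l1 + s * l2 = 1" using T(2) by (metis scaleR_cancel_right scaleR_one)
  then have sum0: "(1 - s) * (1 - l1) + s * (1 - l2) = 0" by (simp add: algebra_simps)
  have "l1 \<le> 1" "l2 \<le> 1" using E12 energy_scaled[OF l1] energy_scaled[OF l2] E by auto
  then have "(1 - s) * (1 - l1) \<ge> 0" "s * (1 - l2) \<ge> 0" using s by auto
  with sum0 have "(1 - s) * (1 - l1) = 0" "s * (1 - l2) = 0" by linarith+
  then have "l1 = 1" "l2 = 1" using s by auto
  moreover have "\<Omega> \<noteq> {}" using T(1) triangle(2,4) by blast
  ultimately have "u1 = u2"
    using P1_mean_zero_eqI[OF u Z(1) l1] P1_mean_zero_eqI[OF u Z(2) l2] by simp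
  with u12(3) show False ..
qed

text \<open>
  On the triangle \<open>T\<close> the quotient \<open>(v x - v z) / (u x - u z)\<close> is the factor \<open>l T\<close>. It is continuous on
  a punctured disc, which is connected, and has finitely many values, so all these factors agree.
\<close>

lemma proportional_around_point:
  assumes u: "u \<in> P1 \<Omega> \<T>" and v: "v \<in> P1 \<Omega> \<T>" and z: "z \<in> \<Omega>"
    and ne: "\<And>T x. T \<in> \<T> \<Longrightarrow> z \<in> closure T \<Longrightarrow> x \<in> closure T \<Longrightarrow> x \<in> \<Omega> \<Longrightarrow> x \<noteq> z \<Longrightarrow> u x \<noteq> u z"
    and par: "\<And>T. T \<in> \<T> \<Longrightarrow> z \<in> closure T \<Longrightarrow> \<exists>l. grad v T = l *\<^sub>R grad u T"
  shows "\<exists>l. \<forall>T\<in>\<T>. z \<in> closure T \<longrightarrow> grad v T = l *\<^sub>R grad u T"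
proof -
  \<comment> \<open>A small disc around \<open>z\<close> meets only those closed triangles that contain \<open>z\<close>.\<close>
  define C where "C = (\<Union>T\<in>{T\<in>\<T>. z \<notin> closure T}. closure T)"
  have "closed C" unfolding C_def using finite_triangles by (intro closed_UN) auto
  then have "open (\<Omega> - C)" using open_domain by (intro open_Diff)
  moreover have "z \<in> \<Omega> - C" using z by (auto simp: C_def)
  ultimately obtain r where r: "r > 0" "ball z r \<subseteq> \<Omega> - C" by (meson openE)
  define B where "B = ball z r - {z}"
  have B_sub: "B \<subseteq> \<Omega>" using r by (auto simp: B_def)
  have B_tri: "\<exists>T\<in>\<T>. z \<in> closure T \<and> x \<in> closure T" if "x \<in> B" for x
  proof -
    have x: "x \<in> \<Omega>" "x \<notin> C" using r(2) that by (auto simp: B_def)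
    obtain T where "T \<in> \<T>" "x \<in> closure T" using in_closed_triangle[OF x(1)] .
    with x(2) show ?thesis by (auto simp: C_def)
  qed
  obtain l where l: "\<And>T. T \<in> \<T> \<Longrightarrow> z \<in> closure T \<Longrightarrow> grad v T = l T *\<^sub>R grad u T"
    using par by metis
  have rel: "v x - v z = l T * (u x - u z)" if T: "T \<in> \<T>" "z \<in> closure T" "x \<in> closure T" "x \<in> \<Omega>" for T x
  proof -
    obtain c where "\<forall>x\<in>closure T \<inter> \<Omega>. u x = grad u T \<bullet> x + c"
      using P1_affine_on_closed_triangle[OF u T(1)] by blast
    moreover obtain d where "\<forall>x\<in>closure T \<inter> \<Omega>. v x = grad v T \<bullet> x + d"
      using P1_affine_on_closed_triangle[OF v T(1)] by blast
    ultimately show ?thesis using T z by (simp add: l[OF T(1,2)] algebra_simps)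
  qed
  have u_ne: "u x - u z \<noteq> 0" if x: "x \<in> B" for x
  proof -
    obtain T where "T \<in> \<T>" "z \<in> closure T" "x \<in> closure T" using B_tri[OF x] by blast
    then show ?thesis using ne[of T x] x B_sub by (auto simp: B_def)
  qed
  define q where "q x = (v x - v z) / (u x - u z)" for x
  have "continuous_on B q" unfolding q_def
    by (intro continuous_intros continuous_on_subset[OF P1_continuous[OF u] B_sub]
        continuous_on_subset[OF P1_continuous[OF v] B_sub]) (use u_ne in auto)
  moreover have "finite (q ` B)"
  proof (rule finite_subset)
    show "q ` B \<subseteq> l ` \<T>"
    proof
      fix y assume "y \<in> q ` B"
      then obtain x where x: "x \<in> B" "y = q x" by blast
      obtain T where T: "T \<in> \<T>" "z \<in> closure T" "x \<in> closure T" using B_tri[OF x(1)] by blast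
      have "x \<in> \<Omega>" using x(1) B_sub by blast
      then have "y = l T" using rel[OF T] u_ne[OF x(1)] by (simp add: x(2) q_def)
      then show "y \<in> l ` \<T>" using T(1) by blast
    qed
  qed (use finite_triangles in simp)
  moreover have "connected B" unfolding B_def by (rule connected_punctured_ball) simp
  ultimately have "q constant_on B" by (intro continuous_finite_range_constant)
  then obtain k where k: "\<And>x. x \<in> B \<Longrightarrow> q x = k" unfolding constant_on_def by blast
  have "grad v T = k *\<^sub>R grad u T" if T: "T \<in> \<T>" "z \<in> closure T" for T
  proof -
    obtain y where y: "y \<in> T" "y \<in> ball z r"
      using T(2) r(1) closure_approachable[of z T] by (auto simp: dist_commute)
    have "open (T \<inter> ball z r)" using triangle(3)[OF T(1)] by auto
    then have "infinite (T \<inter> ball z r)"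
      using y finite_imp_not_open by blast
    then have "infinite (T \<inter> ball z r - {z})" by simp
    then obtain x where x: "x \<in> T" "x \<in> B" unfolding B_def using infinite_imp_nonempty by blast
    have "x \<in> closure T" "x \<in> \<Omega>" using x(1) closure_subset triangle(2)[OF T(1)] by auto
    then have "q x = l T" using rel[OF T] u_ne[OF x(2)] by (simp add: q_def)
    then show ?thesis using l[OF T] k[OF x(2)] by simp
  qed
  then show ?thesis by blast
qed

text \<open>
  The values \<open>1\<close> and \<open>- t\<close> have opposite signs in order that \<open>z1\<close> is a strict maximum and \<open>z2\<close> a strict
  minimum on the surrounding triangles. This gives one factor around each of the two vertices, and the
  common triangle \<open>T0\<close>, where the gradient is nonzero, identifies them. On triangles at neither vertex the
  gradient is zero.
\<close>

lemma two_vertex_interpolant_rigid: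
  assumes z: "z1 \<in> \<Omega>" "z2 \<in> \<Omega>" "z1 \<noteq> z2"
    and T0: "T0 \<in> \<T>" "z1 \<in> vertices T0" "z2 \<in> vertices T0"
    and t: "t > 0" and u: "u \<in> P1 \<Omega> \<T>"
    and nodal: "\<And>T. T \<in> \<T> \<Longrightarrow> \<exists>k. (\<forall>v\<in>vertices T. grad u T \<bullet> v + k = (if v = z1 then 1 else if v = z2 then - t else 0)) \<and>
        (\<forall>x\<in>closure T \<inter> \<Omega>. u x = grad u T \<bullet> x + k)"
  shows "rigid u"
  unfolding rigid_def
proof (intro ballI impI)
  fix v assume v: "v \<in> P1 \<Omega> \<T>" and par: "\<forall>T\<in>\<T>. \<exists>l. grad v T = l *\<^sub>R grad u T"
  have in_closure: "z \<in> closure T" if "z \<in> vertices T" for z T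
    using that by (simp add: vertices_def extreme_point_of_def)
  have max: "u x \<noteq> u z1" if T: "T \<in> \<T>" "z1 \<in> closure T" "x \<in> closure T" "x \<in> \<Omega>" "x \<noteq> z1" for T x
  proof -
    obtain k where k: "\<forall>v\<in>vertices T. grad u T \<bullet> v + k = (if v = z1 then 1 else if v = z2 then - t else 0)"
        "\<forall>x\<in>closure T \<inter> \<Omega>. u x = grad u T \<bullet> x + k" using nodal[OF T(1)] by blast
    have z1: "z1 \<in> vertices T" by (rule vertex_of_incident_triangle[OF T0(1,2) T(1,2)])
    have "grad u T \<bullet> w < grad u T \<bullet> z1" if "w \<in> vertices T" "w \<noteq> z1" for w
    proof -
      have "grad u T \<bullet> z1 + k = 1" using k(1) z1 by simp
      moreover have "grad u T \<bullet> w + k < 1" using k(1) that t by simp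
      ultimately show ?thesis by linarith
    qed
    from strict_max_on_triangle[OF triangle(1)[OF T(1)] z1 this T(3,5)] k(2) T z(1)
    show ?thesis by simp
  qed
  have min: "u x \<noteq> u z2" if T: "T \<in> \<T>" "z2 \<in> closure T" "x \<in> closure T" "x \<in> \<Omega>" "x \<noteq> z2" for T x
  proof -
    obtain k where k: "\<forall>v\<in>vertices T. grad u T \<bullet> v + k = (if v = z1 then 1 else if v = z2 then - t else 0)"
        "\<forall>x\<in>closure T \<inter> \<Omega>. u x = grad u T \<bullet> x + k" using nodal[OF T(1)] by blast
    have z2: "z2 \<in> vertices T" by (rule vertex_of_incident_triangle[OF T0(1,3) T(1,2)])
    have "- grad u T \<bullet> w < - grad u T \<bullet> z2" if "w \<in> vertices T" "w \<noteq> z2" for w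
    proof -
      have "grad u T \<bullet> z2 + k = - t" using k(1) z2 z(3) by simp
      moreover have "grad u T \<bullet> w + k > - t" using k(1) that t by simp
      ultimately show ?thesis by simp
    qed
    from strict_max_on_triangle[OF triangle(1)[OF T(1)] z2 this T(3,5)] k(2) T z(2)
    show ?thesis by simp
  qed
  have "\<exists>l. \<forall>T\<in>\<T>. z1 \<in> closure T \<longrightarrow> grad v T = l *\<^sub>R grad u T"
    using max par by (intro proportional_around_point[OF u v z(1)]) simp_all
  then obtain l1 where l1: "\<forall>T\<in>\<T>. z1 \<in> closure T \<longrightarrow> grad v T = l1 *\<^sub>R grad u T" ..
  have "\<exists>l. \<forall>T\<in>\<T>. z2 \<in> closure T \<longrightarrow> grad v T = l *\<^sub>R grad u T"
    using min par by (intro proportional_around_point[OF u v z(2)]) simp_all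
  then obtain l2 where l2: "\<forall>T\<in>\<T>. z2 \<in> closure T \<longrightarrow> grad v T = l2 *\<^sub>R grad u T" ..
  have "grad u T0 \<noteq> 0"
  proof
    assume "grad u T0 = 0"
    moreover obtain k where k: "\<forall>v\<in>vertices T0. grad u T0 \<bullet> v + k = (if v = z1 then 1 else if v = z2 then - t else 0)"
      using nodal[OF T0(1)] by blast
    ultimately have "k = 1" "k = - t" using bspec[OF k T0(2)] bspec[OF k T0(3)] z(3) by simp_all
    with t show False by simp
  qed
  moreover have "l1 *\<^sub>R grad u T0 = l2 *\<^sub>R grad u T0"
    using l1 l2 T0 in_closure by metis
  ultimately have l12: "l1 = l2" by simp
  have "grad v T = l1 *\<^sub>R grad u T" if T: "T \<in> \<T>" for T
  proof (cases "z1 \<in> vertices T \<or> z2 \<in> vertices T")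
    case True
    then show ?thesis using T l1 l2 l12 in_closure by metis
  next
    case False
    obtain k where k: "\<forall>v\<in>vertices T. grad u T \<bullet> v + k = (if v = z1 then 1 else if v = z2 then - t else 0)"
      using nodal[OF T] by blast
    have "grad u T = 0"
    proof (rule linear_functional_eq_0_if_const_on_vertices[OF triangle(1)[OF T]])
      fix w assume "w \<in> vertices T"
      with k False have "grad u T \<bullet> w + k = 0" by auto
      then show "grad u T \<bullet> w = - k" by simp
    qed
    with par T show ?thesis by auto
  qed
  then show "\<exists>l. \<forall>T\<in>\<T>. grad v T = l *\<^sub>R grad u T" by blast
qed

text \<open>
  Rigidity only depends on the gradients up to a common factor, so it survives subtracting the
  mean and dividing by the energy.
\<close>

lemma exists_normalized_extremal:
  assumes u: "u \<in> P1 \<Omega> \<T>" and rigid: "rigid u" and T0: "T0 \<in> \<T>" "grad u T0 \<noteq> 0"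
  obtains e n where "extremal_in e (TV_ball \<Omega> \<T>)" "n > 0" "grad e T0 = n *\<^sub>R grad u T0"
proof -
  define n where "n = inverse (energy u)"
  have "0 < measure lborel T0 * norm (grad u T0)"
    using measure_lborel_open_pos[OF triangle(3,4,6)[OF T0(1)]] T0(2) by simp
  also have "\<dots> \<le> energy u"
    unfolding energy_def using T0(1) finite_triangles by (intro member_le_sum) auto
  finally have E: "energy u > 0" .
  then have n: "n > 0" by (simp add: n_def)
  have "\<Omega> \<noteq> {}" using T0(1) triangle(2,4) by blast
  then have vol: "measure lborel \<Omega> > 0"
    by (intro measure_lborel_open_pos open_domain bounded_domain)
  define c where "c = - n * (LINT x|lborel. u x) / measure lborel \<Omega>"
  define e where "e x = n * u x + 1 * (if x \<in> \<Omega> then c else 0)" for x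
  have eP: "e \<in> P1 \<Omega> \<T>"
    unfolding e_def[abs_def] by (rule P1_linear_combination(1)[OF u P1_const(1)])
  have ge: "grad e T = n *\<^sub>R grad u T" if "T \<in> \<T>" for T
    unfolding e_def[abs_def] P1_linear_combination(2)[OF u P1_const(1) that] P1_const(2)[OF that] by simp
  have "(LINT x|lborel. (if x \<in> \<Omega> then c else 0)) = (LINT x|lborel. indicator \<Omega> x * c)"
    by (intro Bochner_Integration.integral_cong) auto
  also have "\<dots> = measure lborel \<Omega> * c" by simp
  finally have "(LINT x|lborel. e x) = n * (LINT x|lborel. u x) + measure lborel \<Omega> * c"
    unfolding e_def using P1_integrable[OF u] P1_integrable[OF P1_const(1)] by simp
  also have "\<dots> = 0" using vol by (simp add: c_def)
  finally have "e \<in> P1_mean_zero \<Omega> \<T>"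
    using eP P1_set_integral[OF eP] by (simp add: P1_mean_zero_def)
  moreover have "energy e = 1" using energy_scaled[OF ge] n E by (simp add: n_def)
  moreover have "rigid e"
    unfolding rigid_def
  proof (intro ballI impI)
    fix v assume v: "v \<in> P1 \<Omega> \<T>" and par: "\<forall>T\<in>\<T>. \<exists>l. grad v T = l *\<^sub>R grad e T"
    have "\<forall>T\<in>\<T>. \<exists>l. grad v T = l *\<^sub>R grad u T" using par ge by (metis scaleR_scaleR)
    then obtain l where "\<forall>T\<in>\<T>. grad v T = l *\<^sub>R grad u T" using rigid v unfolding rigid_def by blast
    then have "\<forall>T\<in>\<T>. grad v T = (l / n) *\<^sub>R grad e T" using n ge by simp
    then show "\<exists>l. \<forall>T\<in>\<T>. grad v T = l *\<^sub>R grad e T" ..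
  qed
  ultimately have "extremal_in e (TV_ball \<Omega> \<T>)" by (rule rigid_imp_extremal)
  then show thesis using that n ge[OF T0(1)] by blast
qed

text \<open>
  The parameter \<open>t\<close> can be read off from the extremal function: with \<open>z3\<close> the third vertex of \<open>T0\<close>, it
  is minus the ratio of the derivatives in the directions \<open>z2 - z3\<close> and \<open>z1 - z3\<close>, a ratio that
  normalization does not change.
\<close>

lemma infinite_extremal_if_edge_inside:
  assumes z: "z1 \<in> \<Omega>" "z2 \<in> \<Omega>" "z1 \<noteq> z2"
    and T0: "T0 \<in> \<T>" "z1 \<in> vertices T0" "z2 \<in> vertices T0"
  shows "infinite {u. extremal_in u (TV_ball \<Omega> \<T>)}"
proof -
  obtain z3 where z3: "z3 \<in> vertices T0" "z3 \<noteq> z1" "z3 \<noteq> z2"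
  proof -
    obtain a b c where "vertices T0 = {a,b,c}" "a \<noteq> b" "b \<noteq> c" "a \<noteq> c"
      using triangle(1)[OF T0(1)] by (rule open_triangleE)
    with that show thesis by (metis insertI1 insert_commute)
  qed
  have "\<exists>e. extremal_in e (TV_ball \<Omega> \<T>) \<and> grad e T0 \<bullet> (z1 - z3) > 0 \<and>
      grad e T0 \<bullet> (z2 - z3) = - t * (grad e T0 \<bullet> (z1 - z3))" if t: "t > 0" for t :: real
  proof -
    define w where "w v = (if v = z1 then 1 else if v = z2 then - t else 0)" for v
    obtain u where u: "u \<in> P1 \<Omega> \<T>" and nodal: "\<And>T. T \<in> \<T> \<Longrightarrow>
        \<exists>k. (\<forall>v\<in>vertices T. grad u T \<bullet> v + k = w v) \<and> (\<forall>x\<in>closure T \<inter> \<Omega>. u x = grad u T \<bullet> x + k)"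
      using P1_nodal_interpolant[of w] by metis
    obtain k where k: "\<forall>v\<in>vertices T0. grad u T0 \<bullet> v + k = w v" using nodal[OF T0(1)] by blast
    have "grad u T0 \<bullet> z1 + k = 1" "grad u T0 \<bullet> z2 + k = - t" "grad u T0 \<bullet> z3 + k = 0"
      using k T0 z z3 by (auto simp: w_def)
    then have g: "grad u T0 \<bullet> (z1 - z3) = 1" "grad u T0 \<bullet> (z2 - z3) = - t"
      by (simp_all add: inner_diff_right)
    then have "grad u T0 \<noteq> 0" by auto
    moreover have "rigid u"
      by (rule two_vertex_interpolant_rigid[OF z T0 t u]) (use nodal in \<open>simp add: w_def\<close>)
    ultimately obtain e n where "extremal_in e (TV_ball \<Omega> \<T>)" "n > 0" "grad e T0 = n *\<^sub>R grad u T0"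
      using exists_normalized_extremal[OF u _ T0(1)] by metis
    with g show ?thesis by auto
  qed
  then have "\<forall>t\<in>{0::real<..}. \<exists>e. extremal_in e (TV_ball \<Omega> \<T>) \<and> grad e T0 \<bullet> (z1 - z3) > 0 \<and>
      grad e T0 \<bullet> (z2 - z3) = - t * (grad e T0 \<bullet> (z1 - z3))" by simp
  from bchoice[OF this] obtain f where f: "\<forall>t\<in>{0::real<..}. extremal_in (f t) (TV_ball \<Omega> \<T>) \<and>
      grad (f t) T0 \<bullet> (z1 - z3) > 0 \<and> grad (f t) T0 \<bullet> (z2 - z3) = - t * (grad (f t) T0 \<bullet> (z1 - z3))" ..
  have "inj_on f {0<..}"
  proof (rule inj_onI)
    fix s t :: real assume st: "s \<in> {0<..}" "t \<in> {0<..}" "f s = f t"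
    have "grad (f t) T0 \<bullet> (z2 - z3) = - s * (grad (f t) T0 \<bullet> (z1 - z3))"
      using bspec[OF f st(1)] unfolding st(3) by blast
    moreover have "grad (f t) T0 \<bullet> (z2 - z3) = - t * (grad (f t) T0 \<bullet> (z1 - z3))"
      using bspec[OF f st(2)] by blast
    moreover have "grad (f t) T0 \<bullet> (z1 - z3) > 0" using bspec[OF f st(2)] by blast
    ultimately show "s = t" by (simp only: mult_cancel_right neg_equal_iff_equal) linarith
  qed
  then have "infinite (f ` {0<..})" using finite_imageD[of f "{0<..}"] infinite_Ioi[of "0::real"] by blast
  moreover have "f ` {0<..} \<subseteq> {u. extremal_in u (TV_ball \<Omega> \<T>)}" using f by blast
  ultimately show ?thesis by (rule infinite_super[rotated])
qed

end

theorem proposition3p9: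
  fixes \<Omega> :: "(real^2) set" and \<T> :: "(real^2) set set" and z1 z2 :: "real^2"
  assumes "polygonal_domain \<Omega>"
    and "triangulation_of \<Omega> \<T>"
    and "z1 \<in> \<Omega>" and "z2 \<in> \<Omega>" and "z1 \<noteq> z2"
    and "\<exists>T\<in>\<T>. z1 \<in> vertices T \<and> z2 \<in> vertices T"
    and "\<forall>T\<in>\<T>. z1 \<in> vertices T \<or> z2 \<in> vertices T \<longrightarrow> equilateral T"
    and "{z1, z2} \<subseteq> interior (\<Union>T\<in>{T\<in>\<T>. z1 \<in> vertices T \<or> z2 \<in> vertices T}. closure T)"
  shows "infinite {u. extremal_in u (TV_ball \<Omega> \<T>)}"
proof -
  interpret triangulated_domain \<Omega> \<T>
    using assms(1,2) by unfold_locales (auto simp: polygonal_domain_def)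
  obtain T0 where "T0 \<in> \<T>" "z1 \<in> vertices T0" "z2 \<in> vertices T0" using assms(6) by blast
  with assms(3-5) show ?thesis by (rule infinite_extremal_if_edge_inside)
qed

end
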